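(* Let $n\ge3$, let $S_n$ be the star on $[n+1]$ with center $n+1$, and let $A_n^{\mathrm{top}}(k)$ be the number of trees in $\mathcal T_k$ containing no top-centered display of $S_n$. Let $\tau(k,L)$ be the number of labeled trees on $[k]$ with exactly $L$ leaves. Then for every $k\ge2$ $$A_n^{\mathrm{top}}(k)=\sum_{L=0}^{n-1}\tau(k,L)+\frac{n}{k}\tau(k,n).$$ Equivalently, with the formal power series $$T_L(x)=\sum_{k\ge2}\tau(k,L)\frac{x^k}{k!},\qquad A_n^{\mathrm{top}}(x)=\sum_{k\ge2}A_n^{\mathrm{top}}(k)\frac{x^k}{k!},$$ one has $$A_n^{\mathrm{top}}(x)=\sum_{L=0}^{n-1}T_L(x)+n\int_0^x\frac{T_n(t)}{t}\,dt.$$ Moreover $A_n^{\mathrm{top}}(x)$ is rational up to one logarithmic term: there are $R_n(x)\in\mathbb Q(x)$ and $\gamma_n\in\mathbb Q$ with $A_n^{\mathrm{top}}(x)=R_n(x)-\gamma_n\log(1-x)$. For fixed $n\ge3$, as $k\to\infty$, $$A_n^{\mathrm{top}}(k)\sim\frac{k!}{2^{n-2}(n-2)!(n-1)!}\,k^{2n-5}.$$ Finally, let $U_k$ be a uniformly random tree in $\mathcal T_k$ and let $n=n(k)$ be integers with $3\le n(k)<k$ for all sufficiently large $k$. The probability that $U_k$ contains a top-centered display of $S_{n(k)}$ tends to $1$ as $k\to\infty$ when $\limsup_{k\to\infty} n(k)/k<1/e$, and tends to $0$ when $\liminf_{k\to\infty} n(k)/k>1/e$.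
   Context: $[m]=\{1,\dots,m\}$, and $\mathcal T_m$ is the set of trees with vertex set $[m]$ (labeled trees). A leaf is a vertex of degree one. Let $T\in\mathcal T_N$, $U\in\mathcal T_k$. A display of $T$ in $U$ is a pair $(R,q)$ where $R=\{r_1<\cdots<r_N\}\subseteq[k]$ is an $N$-element set (the survivors; $r_i$ represents target vertex $i$) and $q:[k]\to R$ is a retraction ($q(r)=r$ for $r\in R$) such that (1) every fiber $q^{-1}(r_i)$ induces a connected subtree of $U$; (2) after each fiber is contracted to one vertex, the quotient tree, with the vertex coming from $q^{-1}(r_i)$ labeled $i$, is equal to $T$. A display of $S_n$ in $U\in\mathcal T_k$ is top-centered if the survivor representing the center $n+1$ is the largest label $k$ of $U$. The integral is the formal power series integral. *)

theory Defs
  imports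
    "HOL-Probability.Probability"
    "HOL-Computational_Algebra.Computational_Algebra"
    "HOL-Library.Landau_Symbols"
begin

(* Graphs are finite simple undirected graphs, given by a vertex set V and a set E of
   two-element subsets of V.  A labeled tree on {1..m} is identified with its edge set. *)

definition simple_graph :: "nat set \<Rightarrow> nat set set \<Rightarrow> bool" where
  "simple_graph V E \<longleftrightarrow> finite V \<and> (\<forall>e\<in>E. e \<subseteq> V \<and> card e = 2)"

definition graph_connected :: "nat set \<Rightarrow> nat set set \<Rightarrow> bool" where
  "graph_connected V E \<longleftrightarrow> V \<noteq> {} \<and> (\<forall>u\<in>V. \<forall>v\<in>V. (u, v) \<in> {(x, y). {x, y} \<in> E}\<^sup>*)"

(* The cyclic list of the vertices of a cycle; the closing edge is the case Suc i = length c. *)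
definition graph_cycle :: "nat set set \<Rightarrow> nat list \<Rightarrow> bool" where
  "graph_cycle E c \<longleftrightarrow> length c \<ge> 3 \<and> distinct c \<and>
     (\<forall>i<length c. {c ! i, c ! (Suc i mod length c)} \<in> E)"

definition is_tree :: "nat set \<Rightarrow> nat set set \<Rightarrow> bool" where
  "is_tree V E \<longleftrightarrow> simple_graph V E \<and> graph_connected V E \<and> (\<nexists>c. graph_cycle E c)"

definition labeled_trees :: "nat \<Rightarrow> nat set set set" where
  "labeled_trees m = {E. is_tree {1..m} E}"

definition vdegree :: "nat set set \<Rightarrow> nat \<Rightarrow> nat" where
  "vdegree E v = card {e \<in> E. v \<in> e}"

definition leaves :: "nat \<Rightarrow> nat set set \<Rightarrow> nat set" where
  "leaves k E = {v \<in> {1..k}. vdegree E v = 1}"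

definition tau :: "nat \<Rightarrow> nat \<Rightarrow> nat" where
  "tau k L = card {E \<in> labeled_trees k. card (leaves k E) = L}"

definition induced_edges :: "nat set set \<Rightarrow> nat set \<Rightarrow> nat set set" where
  "induced_edges E S = {e \<in> E. e \<subseteq> S}"

(* The i-th smallest element r_i of R, for 1 \<le> i \<le> card R. *)
definition survivor :: "nat set \<Rightarrow> nat \<Rightarrow> nat" where
  "survivor R i = sorted_list_of_set R ! (i - 1)"

definition fiber :: "nat \<Rightarrow> (nat \<Rightarrow> nat) \<Rightarrow> nat \<Rightarrow> nat set" where
  "fiber k q r = {v \<in> {1..k}. q v = r}"

(* The graph obtained from U by contracting each fiber of q, the vertex coming from the fiber
   over r_i being labeled i. *)
definition quotient_edges ::
    "nat \<Rightarrow> nat \<Rightarrow> nat set set \<Rightarrow> nat set \<Rightarrow> (nat \<Rightarrow> nat) \<Rightarrow> nat set set" where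
  "quotient_edges N k U R q =
     {{i, j} | i j. i \<in> {1..N} \<and> j \<in> {1..N} \<and> i \<noteq> j \<and>
        (\<exists>u \<in> fiber k q (survivor R i). \<exists>v \<in> fiber k q (survivor R j). {u, v} \<in> U)}"

(* (R, q) is a display of the tree T on {1..N} in the tree U on {1..k}. *)
definition is_display ::
    "nat \<Rightarrow> nat set set \<Rightarrow> nat \<Rightarrow> nat set set \<Rightarrow> nat set \<Rightarrow> (nat \<Rightarrow> nat) \<Rightarrow> bool" where
  "is_display N T k U R q \<longleftrightarrow>
     R \<subseteq> {1..k} \<and> card R = N \<and>
     q \<in> {1..k} \<rightarrow>\<^sub>E R \<and> (\<forall>r\<in>R. q r = r) \<and>
     (\<forall>i\<in>{1..N}. is_tree (fiber k q (survivor R i))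
                           (induced_edges U (fiber k q (survivor R i)))) \<and>
     quotient_edges N k U R q = T"

definition star :: "nat \<Rightarrow> nat set set" where
  "star n = {{i, n + 1} | i. i \<in> {1..n}}"

definition has_top_star :: "nat \<Rightarrow> nat \<Rightarrow> nat set set \<Rightarrow> bool" where
  "has_top_star n k U \<longleftrightarrow>
     (\<exists>R q. is_display (n + 1) (star n) k U R q \<and> survivor R (n + 1) = k)"

definition A_top :: "nat \<Rightarrow> nat \<Rightarrow> nat" where
  "A_top n k = card {U \<in> labeled_trees k. \<not> has_top_star n k U}"

definition T_series :: "nat \<Rightarrow> rat fps" where
  "T_series L = Abs_fps (\<lambda>k. if k \<ge> 2 then of_nat (tau k L) / fact k else 0)"

definition A_top_series :: "nat \<Rightarrow> rat fps" where
  "A_top_series n = Abs_fps (\<lambda>k. if k \<ge> 2 then of_nat (A_top n k) / fact k else 0)"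

(* fps_ln 1 is the series of log(1 + x). *)
definition log_one_minus :: "rat fps" where
  "log_one_minus = fps_compose (fps_ln 1) (- fps_X)"

definition prob_top_star :: "nat \<Rightarrow> nat \<Rightarrow> real" where
  "prob_top_star n k = measure_pmf.prob (pmf_of_set (labeled_trees k)) {U. has_top_star n k U}"

end

theory Submission
  imports Defs "HOL-Combinatorics.Stirling" "HOL-Combinatorics.Transposition"
begin

text \<open>
  Everything rests on one observation: a tree contains a top-centered display of the star with \<open>n\<close>
  leaves if and only if at least \<open>n\<close> of its own leaves differ from the top vertex \<open>k\<close>
  (\<open>has_top_star_iff_leaves\<close>). Given such leaves, they serve as singleton fibers and the rest of the
  tree, still connected, becomes the center fiber. Conversely, counting edges shows that each
  non-central fiber of a display is joined to the rest by a single edge, and a subtree that hangs on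
  a single edge contains a leaf. So the trees without a display are those with fewer than \<open>n\<close>
  leaves, and those with exactly \<open>n\<close> leaves one of which is \<open>k\<close>. By symmetry under relabeling, a
  fraction \<open>n / k\<close> of the trees with \<open>n\<close> leaves has \<open>k\<close> as a leaf. This is the exact formula
  (\<open>A_top_eq_tau\<close>) and, coefficient by coefficient, the identity of power series.

  The other claims follow from a recurrence for \<open>tau\<close> (\<open>tau_rec\<close>), obtained by removing a marked
  leaf. Its solution is \<open>tau k L = fact k / fact L * S (k - 2) (k - L)\<close>, where \<open>S\<close> denotes the
  Stirling numbers of the second kind (\<open>tau_Stirling\<close>). On a diagonal, where \<open>L\<close> is fixed,
  these are a polynomial in \<open>k\<close> of degree \<open>2 * (L - 2)\<close> with a known leading coefficient
  (\<open>Stirling_diagonal_poly\<close>). A series with polynomial coefficients is rational; the additional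
  division by \<open>k\<close> in \<open>n / k * tau k n\<close> produces a multiple of the logarithm, and the leading
  coefficient of the same term gives the asymptotics.

  For random trees, summing the Stirling formula over \<open>L\<close> gives Cayley's formula
  (\<open>card_labeled_trees\<close>), and the recurrence expresses the first two factorial moments of the number
  of leaves by the numbers of trees with one and two vertices less. Hence the proportion of leaves has
  mean square deviation from \<open>1 / e\<close> tending to zero, and Chebyshev's inequality yields the
  threshold; whether \<open>k\<close> itself is a leaf changes the proportion by at most \<open>1 / k\<close>.
\<close>

section \<open>Trees and their leaves\<close>

lemma is_tree_finite_edges: "is_tree V E \<Longrightarrow> finite E"
  unfolding is_tree_def simple_graph_def by (meson Pow_iff finite_Pow_iff rev_finite_subset subsetI)

lemma is_tree_edge:
  assumes "is_tree V E" "{u, v} \<in> E"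
  shows "u \<in> V" "v \<in> V" "u \<noteq> v"
  using assms unfolding is_tree_def simple_graph_def by (auto dest!: bspec)

lemma is_tree_edgeE:
  assumes "is_tree V E" "e \<in> E"
  obtains u v where "e = {u, v}" "u \<in> V" "v \<in> V" "u \<noteq> v"
  using assms unfolding is_tree_def simple_graph_def
  by (metis card_2_iff insert_subset)

lemma is_tree_edge_at:
  assumes "is_tree V E" "e \<in> E" "v \<in> e"
  obtains u where "e = {v, u}" "u \<in> V" "u \<noteq> v"
  using is_tree_edgeE[OF assms(1,2)] assms(3) by (metis empty_iff insert_commute insert_iff)

lemma is_tree_neighbour:
  assumes "is_tree V E" "x \<in> V" "z \<in> V" "z \<noteq> x"
  obtains y where "{x, y} \<in> E"
proof -
  have "(x, z) \<in> {(x, y). {x, y} \<in> E}\<^sup>*"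
    using assms unfolding is_tree_def graph_connected_def by blast
  then show thesis using assms(4) that by (auto elim: converse_rtranclE)
qed

lemma graph_cycle_neighbours:
  assumes "graph_cycle E c" "x \<in> set c"
  obtains y z where "y \<in> set c" "z \<in> set c" "y \<noteq> z" "{x, y} \<in> E" "{x, z} \<in> E"
proof -
  obtain i where i: "i < length c" "c ! i = x" using assms(2) by (auto simp: in_set_conv_nth)
  define m where "m = length c"
  have m: "m \<ge> 3" "distinct c" and ed: "\<And>j. j < m \<Longrightarrow> {c ! j, c ! (Suc j mod m)} \<in> E"
    using assms(1) unfolding graph_cycle_def m_def by auto
  define a where "a = Suc i mod m"
  define b where "b = (if i = 0 then m - 1 else i - 1)"
  have b: "b < m" "Suc b mod m = i" "a < m"
  proof -
    have "m > 0" using m by auto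
    then show "a < m" unfolding a_def by simp
    show "b < m" "Suc b mod m = i" using i m unfolding b_def m_def by auto
  qed
  have "a \<noteq> b"
  proof (cases "Suc i = m")
    case True
    then show ?thesis using m unfolding a_def b_def by auto
  next
    case False
    then show ?thesis using i m unfolding a_def b_def m_def by auto
  qed
  then have "c ! a \<noteq> c ! b" using b m by (simp add: m_def nth_eq_iff_index_eq)
  moreover have "{x, c ! a} \<in> E" using ed[of i] i unfolding a_def m_def by auto
  moreover have "{x, c ! b} \<in> E" using ed[of b] i b by (auto simp: insert_commute)
  ultimately show thesis using that[of "c ! a" "c ! b"] b by (simp add: m_def)
qed

lemma vdegree_one_neighbour:
  assumes "is_tree V E" "vdegree E v = 1"
  obtains u where "u \<in> V" "u \<noteq> v" "{e \<in> E. v \<in> e} = {{v, u}}"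
proof -
  obtain e where e: "{e \<in> E. v \<in> e} = {e}"
    using assms(2) unfolding vdegree_def by (metis (no_types, lifting) card_1_singletonE)
  then have "e \<in> E" "v \<in> e" by blast+
  then show thesis using is_tree_edge_at[OF assms(1)] e that by metis
qed

text \<open>A walk between other vertices that visits the leaf \<open>v\<close> enters and leaves it through its only
  neighbour \<open>u\<close>, so the visit can be cut out.\<close>

lemma is_tree_remove_leaf:
  assumes T: "is_tree V E" and deg: "vdegree E v = 1"
  shows "is_tree (V - {v}) {e \<in> E. v \<notin> e}"
proof -
  obtain u where u: "u \<in> V" "u \<noteq> v" and star: "{e \<in> E. v \<in> e} = {{v, u}}"
    using vdegree_one_neighbour[OF T deg] by metis
  let ?E = "{e \<in> E. v \<notin> e}"
  have nb: "w = u" if "{v, w} \<in> E" for w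
  proof -
    have "{v, w} \<in> {{v, u}}" unfolding star[symmetric] using that by auto
    then show ?thesis using u by (auto simp: doubleton_eq_iff)
  qed
  \<comment> \<open>The invariant replaces the endpoint \<open>v\<close> by \<open>u\<close> while the walk is at \<open>v\<close>.\<close>
  have reach: "(b \<noteq> v \<longrightarrow> (a, b) \<in> {(x, y). {x, y} \<in> ?E}\<^sup>*) \<and>
      (b = v \<longrightarrow> (a, u) \<in> {(x, y). {x, y} \<in> ?E}\<^sup>*)"
    if "(a, b) \<in> {(x, y). {x, y} \<in> E}\<^sup>*" "a \<noteq> v" for a b
    using that
  proof (induction rule: rtrancl_induct)
    case base
    then show ?case by auto
  next
    case (step b c)
    have bc: "{b, c} \<in> E" using step by auto
    have bc2: "{c, b} \<in> E" using bc by (simp add: insert_commute)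
    consider "b = v" "c = u" | "c = v" "b = u" | "b \<noteq> v" "c \<noteq> v"
      using nb[of c] nb[of b] bc bc2 by blast
    then show ?case
    proof cases
      case 3
      then have "(b, c) \<in> {(x, y). {x, y} \<in> ?E}" using bc by auto
      then show ?thesis using 3 step by (auto intro: rtrancl_into_rtrancl)
    qed (use step u in auto)
  qed
  have "graph_connected (V - {v}) ?E"
    unfolding graph_connected_def
  proof (intro conjI ballI)
    show "V - {v} \<noteq> {}" using u by auto
    fix a b assume "a \<in> V - {v}" "b \<in> V - {v}"
    then show "(a, b) \<in> {(x, y). {x, y} \<in> ?E}\<^sup>*"
      using reach[of a b] T unfolding is_tree_def graph_connected_def by auto
  qed
  moreover have "simple_graph (V - {v}) ?E"
    using T unfolding is_tree_def simple_graph_def by auto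
  moreover have "graph_cycle E c" if "graph_cycle ?E c" for c
    using that unfolding graph_cycle_def by auto
  ultimately show ?thesis using T unfolding is_tree_def by blast
qed

text \<open>No new cycle can arise: it would have to visit \<open>v\<close>, whose only neighbour is \<open>u\<close>, while a
  vertex of a cycle has two neighbours on it.\<close>

lemma is_tree_attach_leaf:
  assumes T: "is_tree V E" and u: "u \<in> V" and v: "v \<notin> V"
  shows "is_tree (insert v V) (insert {u, v} E)"
proof -
  let ?E = "insert {u, v} E"
  let ?r = "{(x, y). {x, y} \<in> ?E}\<^sup>*"
  have notE: "v \<notin> e" if "e \<in> E" for e
    using T v that unfolding is_tree_def simple_graph_def by auto
  have sym: "(a, b) \<in> ?r \<Longrightarrow> (b, a) \<in> ?r" for a b
    by (rule symD[OF sym_rtrancl]) (auto simp: sym_def insert_commute)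
  have mono: "{(x, y). {x, y} \<in> E}\<^sup>* \<subseteq> ?r" by (rule rtrancl_mono) auto
  have fromu: "(u, a) \<in> ?r" if "a \<in> insert v V" for a
  proof (cases "a = v")
    case False
    then show ?thesis using that T u mono unfolding is_tree_def graph_connected_def by blast
  qed (auto intro: r_into_rtrancl)
  have "graph_connected (insert v V) ?E"
    unfolding graph_connected_def using fromu sym by (blast intro: rtrancl_trans)
  moreover have "simple_graph (insert v V) ?E"
    using T u v unfolding is_tree_def simple_graph_def by (auto simp: card_insert_if)
  moreover have "\<not> graph_cycle ?E c" for c
  proof
    assume c: "graph_cycle ?E c"
    show False
    proof (cases "v \<in> set c")
      case True
      then obtain y z where "y \<noteq> z" "{v, y} \<in> ?E" "{v, z} \<in> ?E"
        using graph_cycle_neighbours[OF c] by metis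
      then have "{v, y} = {u, v}" "{v, z} = {u, v}" using notE by blast+
      then show False using \<open>y \<noteq> z\<close> by (auto simp: doubleton_eq_iff)
    next
      case False
      have "{c ! i, c ! (Suc i mod length c)} \<in> E" if "i < length c" for i
      proof -
        have "c ! i \<noteq> v" "c ! (Suc i mod length c) \<noteq> v"
          using False that by (metis mod_less_divisor nth_mem gr_implies_not0 neq0_conv)+
        then show ?thesis using c that unfolding graph_cycle_def
          by (metis insert_iff singletonD)
      qed
      then have "graph_cycle E c" using c unfolding graph_cycle_def by auto
      then show False using T unfolding is_tree_def by blast
    qed
  qed
  ultimately show ?thesis unfolding is_tree_def by blast
qed

lemma is_tree_singleton: "is_tree {v} {}"
proof -
  have "\<not> graph_cycle {} c" for c
  proof
    assume "graph_cycle {} c"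
    then have "c \<noteq> []" "\<forall>i<length c. {c ! i, c ! (Suc i mod length c)} \<in> {}"
      unfolding graph_cycle_def by auto
    then show False by auto
  qed
  then show ?thesis
    unfolding is_tree_def simple_graph_def graph_connected_def by auto
qed

text \<open>The first vertex of a longest path is a leaf: any further neighbour would either prolong
  the path or close a cycle with a segment of it.\<close>

lemma is_tree_has_leaf:
  assumes T: "is_tree V E" and card: "card V \<ge> 2"
  obtains v where "v \<in> V" "vdegree E v = 1"
proof -
  have fin: "finite V" using T unfolding is_tree_def simple_graph_def by simp
  have nocyc: "\<not> graph_cycle E c" for c using T unfolding is_tree_def by blast
  define P where "P p \<longleftrightarrow> p \<noteq> [] \<and> distinct p \<and> set p \<subseteq> V \<and>
    (\<forall>i. Suc i < length p \<longrightarrow> {p ! i, p ! Suc i} \<in> E)" for p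
  obtain w where "w \<in> V" using card by fastforce
  then have "P [w]" unfolding P_def by auto
  moreover have "\<forall>p. P p \<longrightarrow> length p < Suc (card V)"
    using fin unfolding P_def by (metis card_mono distinct_card le_imp_less_Suc)
  ultimately obtain p where p: "P p" and max: "\<And>p'. P p' \<Longrightarrow> length p' \<le> length p"
    using ex_has_greatest_nat[of P "[w]" length "Suc (card V)"] by auto
  define x where "x = p ! 0"
  have xV: "x \<in> V" using p unfolding P_def x_def by (metis length_greater_0_conv nth_mem subsetD)
  have second: "p ! 1 = y" if y: "{x, y} \<in> E" for y
  proof -
    have yV: "y \<in> V" "x \<noteq> y" using is_tree_edge[OF T y] by auto
    have "y \<in> set p"
    proof (rule ccontr)
      assume "y \<notin> set p"
      then have "P (y # p)" using p y yV unfolding P_def x_def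
        by (auto simp: nth_Cons insert_commute split: nat.splits)
      then show False using max by fastforce
    qed
    then obtain j where j: "j < length p" "p ! j = y" by (auto simp: in_set_conv_nth)
    have "j \<noteq> 0" using j yV unfolding x_def by metis
    moreover have "\<not> j \<ge> 2"
    proof
      assume j2: "j \<ge> 2"
      \<comment> \<open>The edge from \<open>y = p ! j\<close> back to \<open>x = p ! 0\<close> closes this segment.\<close>
      have "graph_cycle E (take (Suc j) p)"
        unfolding graph_cycle_def
      proof (intro conjI allI impI)
        show "3 \<le> length (take (Suc j) p)" using j j2 by auto
        show "distinct (take (Suc j) p)" using p unfolding P_def by auto
        fix i assume i: "i < length (take (Suc j) p)"
        show "{take (Suc j) p ! i, take (Suc j) p ! (Suc i mod length (take (Suc j) p))} \<in> E"
        proof (cases "i = j")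
          case True
          have "length (take (Suc j) p) = Suc j" using j by simp
          moreover have "{p ! j, p ! 0} \<in> E" using j y unfolding x_def by (metis insert_commute)
          ultimately show ?thesis using True j by simp
        next
          case False
          then show ?thesis using i j p unfolding P_def by (auto simp: min_def)
        qed
      qed
      then show False using nocyc by blast
    qed
    ultimately have "j = 1" by linarith
    then show ?thesis using j by simp
  qed
  obtain z where "z \<in> V" "z \<noteq> x"
  proof -
    have "V \<noteq> {x}" using card by auto
    then show thesis using that xV by blast
  qed
  then obtain y where y: "{x, y} \<in> E" using is_tree_neighbour[OF T xV] by metis
  have "{e \<in> E. x \<in> e} = {{x, y}}"
  proof (intro equalityI subsetI)
    fix e assume e: "e \<in> {e \<in> E. x \<in> e}"
    then obtain u where u: "e = {x, u}" using is_tree_edge_at[OF T] by blast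
    then have "u = y" using second[of u] second[of y] y e by auto
    then show "e \<in> {{x, y}}" using u by simp
  qed (use y in auto)
  then have "vdegree E x = 1" unfolding vdegree_def by simp
  then show thesis using that xV by blast
qed

lemma is_tree_card:
  assumes "is_tree V E"
  shows "card V = Suc (card E)"
  using assms
proof (induction "card V" arbitrary: V E rule: less_induct)
  case less
  have fin: "finite V" and finE: "finite E" and ne: "V \<noteq> {}"
    using less.prems is_tree_finite_edges
    unfolding is_tree_def simple_graph_def graph_connected_def by auto
  show ?case
  proof (cases "card V \<ge> 2")
    case True
    then obtain v where v: "v \<in> V" "vdegree E v = 1" using is_tree_has_leaf less.prems by metis
    let ?E = "{e \<in> E. v \<notin> e}"
    have "card (V - {v}) = Suc (card ?E)"
      using less.hyps[OF _ is_tree_remove_leaf[OF less.prems v(2)]] v fin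
      by (meson card_Diff1_less)
    moreover have "card E = card ?E + card {e \<in> E. v \<in> e}"
      using finE by (subst card_Un_disjoint[symmetric]) (auto intro: arg_cong[where f = card])
    ultimately show ?thesis
      using v fin unfolding vdegree_def by (simp add: card_Suc_Diff1 card_Diff_singleton)
  next
    case False
    moreover have "card V \<noteq> 0" using fin ne by auto
    ultimately have "card V = 1" by linarith
    then obtain w where w: "V = {w}" by (metis card_1_singletonE)
    have "E = {}" using is_tree_edgeE[OF less.prems] w by (metis all_not_in_conv singletonD)
    then show ?thesis using w by auto
  qed
qed

section \<open>Top-centered star displays and leaves\<close>

text \<open>The vertex \<open>r\<close> that stays guarantees that a leaf in \<open>A\<close> does not become isolated, and hence is still
  a leaf when its turn comes.\<close>

lemma is_tree_remove_leaves:
  assumes T: "is_tree V E" and "finite A" "A \<subseteq> V" and deg: "\<And>a. a \<in> A \<Longrightarrow> vdegree E a = 1"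
    and r: "r \<in> V - A"
  shows "is_tree (V - A) (induced_edges E (V - A))"
  using assms(2,3) deg r
proof (induction A rule: finite_induct)
  case empty
  have "induced_edges E V = E"
    using T unfolding induced_edges_def is_tree_def simple_graph_def by auto
  then show ?case using T by simp
next
  case (insert a A)
  let ?E = "induced_edges E (V - A)"
  have T': "is_tree (V - A) ?E" using insert by auto
  obtain y where y: "{a, y} \<in> ?E"
    using is_tree_neighbour[OF T', of a r] insert by auto
  have fin: "finite E" using T is_tree_finite_edges by blast
  have "card {e \<in> ?E. a \<in> e} \<le> card {e \<in> E. a \<in> e}"
    by (rule card_mono) (use fin in \<open>auto simp: induced_edges_def\<close>)
  moreover have "card {e \<in> ?E. a \<in> e} > 0"
  proof -
    have "finite {e \<in> ?E. a \<in> e}" using fin by (simp add: induced_edges_def)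
    moreover have "{a, y} \<in> {e \<in> ?E. a \<in> e}" using y by blast
    ultimately show ?thesis by (metis card_gt_0_iff empty_iff)
  qed
  moreover have "card {e \<in> E. a \<in> e} = 1" using insert.prems(2)[of a] unfolding vdegree_def by simp
  ultimately have "vdegree ?E a = 1" unfolding vdegree_def by linarith
  from is_tree_remove_leaf[OF T' this]
  have "is_tree (V - A - {a}) {e \<in> ?E. a \<notin> e}" .
  moreover have "{e \<in> ?E. a \<notin> e} = induced_edges E (V - insert a A)"
    unfolding induced_edges_def by auto
  moreover have "V - A - {a} = V - insert a A" by auto
  ultimately show ?case by simp
qed

lemma bij_betw_survivor:
  assumes "finite R" "card R = N"
  shows "bij_betw (survivor R) {1..N} R"
proof -
  have "bij_betw ((!) (sorted_list_of_set R)) {..<N} R"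
    using assms by (intro bij_betw_nth) auto
  moreover have "bij_betw (\<lambda>i. i - 1) {1..N} {..<N}"
    by (rule bij_betw_byWitness[where f' = Suc]) auto
  ultimately have "bij_betw ((!) (sorted_list_of_set R) \<circ> (\<lambda>i. i - 1)) {1..N} R"
    by (rule bij_betw_trans[rotated])
  then show ?thesis by (simp add: survivor_def[abs_def] comp_def)
qed

text \<open>The center is the last survivor, so it is the top vertex as soon as that one survives; the other
  survivors may be numbered in any order, the star being symmetric in its leaves.\<close>

lemma survivor_last:
  assumes "R \<subseteq> {1..k}" "k \<in> R" "card R = n + 1"
  shows "survivor R (n + 1) = k"
proof -
  let ?xs = "sorted_list_of_set R"
  have fin: "finite R" using assms(1) finite_subset by blast
  have len: "length ?xs = n + 1" using assms by simp
  obtain j where j: "j < n + 1" "?xs ! j = k"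
    using assms(2) fin len by (metis in_set_conv_nth set_sorted_list_of_set)
  have "k \<le> ?xs ! n" using sorted_nth_mono[of ?xs j n] j len by auto
  moreover have "?xs ! n \<in> R" using len fin by (metis less_add_one nth_mem set_sorted_list_of_set)
  ultimately show ?thesis using assms(1) by (auto simp: survivor_def)
qed

text \<open>Keeping \<open>n\<close> leaves as singleton fibers and merging everything else into the center gives
  a display, because deleting leaves does not disconnect a tree.\<close>

lemma has_top_star_if_leaves:
  assumes U: "U \<in> labeled_trees k" and k: "k \<ge> 1" and A: "A \<subseteq> leaves k U - {k}" "card A = n"
  shows "has_top_star n k U"
proof -
  let ?V = "{1..k}"
  have T: "is_tree ?V U" using U unfolding labeled_trees_def by auto
  have deg: "vdegree U a = 1" if "a \<in> A" for a
    using A that unfolding leaves_def by blast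
  have fin: "finite A"
    by (rule finite_subset[OF A(1)]) (simp add: leaves_def)
  have AV: "A \<subseteq> ?V" "k \<notin> A" using A unfolding leaves_def by auto
  define R where "R = insert k A"
  define q where "q = restrict (\<lambda>v. if v \<in> A then v else k) ?V"
  have R: "R \<subseteq> ?V" "card R = n + 1" "finite R" using AV fin A k unfolding R_def by auto
  have last: "survivor R (n + 1) = k" using survivor_last R unfolding R_def by blast
  have bij: "bij_betw (survivor R) {1..n+1} R" using bij_betw_survivor R by blast
  have surv: "survivor R i \<in> A" if "i \<in> {1..n}" for i
  proof -
    have "survivor R i \<noteq> survivor R (n + 1)"
      using bij that unfolding bij_betw_def inj_on_def by (metis Suc_eq_plus1 atLeastAtMost_iff
          le_add2 le_SucI not_less_eq_eq order_refl)
    moreover have "survivor R i \<in> R" using bij that by (auto simp: bij_betw_def)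
    ultimately show ?thesis using last unfolding R_def by auto
  qed
  have fibA: "fiber k q a = {a}" if "a \<in> A" for a
    using that AV unfolding fiber_def q_def by auto
  have fibk: "fiber k q k = ?V - A"
    using AV unfolding fiber_def q_def by auto
  \<comment> \<open>Two leaves in \<open>A\<close> are not adjacent: deleting only the other ones keeps \<open>a\<close> connected to \<open>k\<close>.\<close>
  have nb: "\<exists>y \<in> ?V - A. {e \<in> U. a \<in> e} = {{a, y}}" if a: "a \<in> A" for a
  proof -
    have "is_tree (?V - (A - {a})) (induced_edges U (?V - (A - {a})))"
      using is_tree_remove_leaves[OF T, of "A - {a}" k] fin AV k deg by auto
    from is_tree_neighbour[OF this, of a k]
    obtain y where y: "{a, y} \<in> induced_edges U (?V - (A - {a}))"
      using a AV k by (metis DiffD2 DiffI DiffE atLeastAtMost_iff insertI1 le_refl subsetD)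
    then have 1: "{a, y} \<in> U" "y \<in> ?V - (A - {a})" unfolding induced_edges_def by auto
    moreover have "y \<noteq> a" using is_tree_edge[OF T 1(1)] by auto
    moreover obtain u where u: "{e \<in> U. a \<in> e} = {{a, u}}"
      using vdegree_one_neighbour[OF T deg[OF a]] by metis
    moreover have "{a, y} \<in> {{a, u}}" unfolding u[symmetric] using 1 by blast
    ultimately show ?thesis by blast
  qed
  have nbA: "y \<notin> A" if aA: "a \<in> A" and ay: "{a, y} \<in> U" for a y
  proof -
    obtain z where z: "z \<in> ?V - A" "{e \<in> U. a \<in> e} = {{a, z}}"
      using nb[OF aA] by blast
    have "{a, y} \<in> {e \<in> U. a \<in> e}" using ay by simp
    then have "{a, y} \<in> {{a, z}}" by (simp only: z(2))
    then show ?thesis using z aA by (auto simp: doubleton_eq_iff)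
  qed
  have "is_display (n + 1) (star n) k U R q"
    unfolding is_display_def
  proof (intro conjI ballI)
    show "R \<subseteq> ?V" "card R = n + 1" using R by auto
    show "q \<in> ?V \<rightarrow>\<^sub>E R" unfolding q_def R_def by auto
    show "q r = r" if "r \<in> R" for r using that AV k unfolding q_def R_def by auto
    show "is_tree (fiber k q (survivor R i)) (induced_edges U (fiber k q (survivor R i)))"
      if i: "i \<in> {1..n+1}" for i
    proof (cases "i = n + 1")
      case True
      then show ?thesis
        using is_tree_remove_leaves[OF T fin _ deg, of k] AV k last fibk by auto
    next
      case False
      then have "survivor R i \<in> A" using i surv by auto
      moreover have "induced_edges U {a} = {}" for a
        using T unfolding induced_edges_def is_tree_def simple_graph_def
        by (auto dest!: subset_singletonD)
      ultimately show ?thesis using fibA is_tree_singleton by simp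
    qed
    show "quotient_edges (n + 1) k U R q = star n"
    proof (intro equalityI subsetI)
      fix e assume "e \<in> quotient_edges (n + 1) k U R q"
      then obtain i j u v where e: "e = {i, j}" "i \<in> {1..n+1}" "j \<in> {1..n+1}" "i \<noteq> j"
        "u \<in> fiber k q (survivor R i)" "v \<in> fiber k q (survivor R j)" "{u, v} \<in> U"
        unfolding quotient_edges_def by auto
      have "i = n + 1 \<or> j = n + 1"
      proof (rule ccontr)
        assume "\<not> ?thesis"
        then have "survivor R i \<in> A" "survivor R j \<in> A" using surv e by auto
        then have "u \<in> A" "v \<in> A" using e fibA by auto
        then show False using nbA e by blast
      qed
      then show "e \<in> star n" using e unfolding star_def by (auto simp: insert_commute)
    next
      fix e assume "e \<in> star n"
      then obtain i where i: "i \<in> {1..n}" "e = {i, n + 1}" unfolding star_def by auto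
      let ?a = "survivor R i"
      have a: "?a \<in> A" using surv i by auto
      obtain y where y: "y \<in> ?V - A" "{e \<in> U. ?a \<in> e} = {{?a, y}}"
        using nb[OF a] by blast
      from y(2) have "{?a, y} \<in> U" by auto
      then have ex: "\<exists>u\<in>fiber k q (survivor R i). \<exists>v\<in>fiber k q (survivor R (n+1)). {u, v} \<in> U"
        unfolding last fibk fibA[OF a] using y(1) by blast
      then show "e \<in> quotient_edges (n + 1) k U R q"
        unfolding quotient_edges_def mem_Collect_eq
        by (intro exI[of _ i] exI[of _ "n + 1"] conjI ex) (use i in auto)
    qed
  qed
  then show ?thesis unfolding has_top_star_def using last by blast
qed

text \<open>Counting the edges of the tree fiber by fiber leaves exactly one edge between the center
  fiber and each other fiber. Hence the degrees in a non-central fiber \<open>F\<close> add up to only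
  \<open>2 * card F - 1\<close>, which forces a leaf in \<open>F\<close>.\<close>

lemma star_display_leaf_in_fiber:
  assumes U: "U \<in> labeled_trees k" and d: "is_display (n + 1) (star n) k U R q"
    and last: "survivor R (n + 1) = k" and r0: "r0 \<in> R - {k}"
  shows "\<exists>v \<in> leaves k U. q v = r0"
proof -
  let ?V = "{1..k}"
  let ?F = "fiber k q"
  let ?I = "\<lambda>r. induced_edges U (?F r)"
  define D where "D r = {e \<in> U. q ` e = {r, k}}" for r
  have T: "is_tree ?V U" using U unfolding labeled_trees_def by auto
  have finU: "finite U" using T is_tree_finite_edges by blast
  have R: "R \<subseteq> ?V" "card R = n + 1" and qR: "\<And>v. v \<in> ?V \<Longrightarrow> q v \<in> R"
    and ret: "\<And>r. r \<in> R \<Longrightarrow> q r = r"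
    and quot: "quotient_edges (n + 1) k U R q = star n"
    using d unfolding is_display_def by auto
  have finR: "finite R" using R finite_subset by blast
  have bij: "bij_betw (survivor R) {1..n+1} R" using bij_betw_survivor R finR by blast
  have kR: "k \<in> R" using bij last unfolding bij_betw_def
    by (metis atLeastAtMost_iff imageI le_add2 order_refl)
  have ex: "\<exists>i \<in> {1..n+1}. survivor R i = r" if "r \<in> R" for r
    using bij that unfolding bij_betw_def by (metis imageE)
  have tree: "is_tree (?F r) (?I r)" if "r \<in> R" for r
    using ex[OF that] d unfolding is_display_def by blast
  have cardF: "card (?F r) = Suc (card (?I r))" if "r \<in> R" for r
    using is_tree_card[OF tree[OF that]] .
  have cross: "q u = k \<or> q v = k" if e: "{u, v} \<in> U" and ne: "q u \<noteq> q v" for u v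
  proof -
    have uv: "u \<in> ?V" "v \<in> ?V" using is_tree_edge[OF T e] by auto
    obtain i j where ij: "i \<in> {1..n+1}" "survivor R i = q u" "j \<in> {1..n+1}" "survivor R j = q v"
      using ex qR uv by meson
    have "{i, j} \<in> quotient_edges (n + 1) k U R q"
      unfolding quotient_edges_def using ij ne e uv by (fastforce simp: fiber_def)
    then have "i = n + 1 \<or> j = n + 1" unfolding quot star_def by (auto simp: doubleton_eq_iff)
    then show ?thesis using ij last by metis
  qed
  have Dne: "D r \<noteq> {}" if r: "r \<in> R - {k}" for r
  proof -
    obtain i where i: "i \<in> {1..n+1}" "survivor R i = r" using ex r by blast
    then have "i \<in> {1..n}" using r last by (cases "i = n + 1") auto
    then have "{i, n + 1} \<in> quotient_edges (n + 1) k U R q" unfolding quot star_def by auto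
    then obtain a b u v where ab: "{i, n + 1} = {a, b}" "u \<in> ?F (survivor R a)"
      "v \<in> ?F (survivor R b)" "{u, v} \<in> U"
      unfolding quotient_edges_def by auto
    then have "{u, v} \<in> D r"
      unfolding D_def using i last by (auto simp: doubleton_eq_iff fiber_def)
    then show ?thesis by blast
  qed
  have U_eq: "U = (\<Union>r\<in>R. ?I r) \<union> (\<Union>r\<in>R - {k}. D r)"
  proof (intro equalityI subsetI)
    fix e assume e: "e \<in> U"
    then obtain u v where uv: "e = {u, v}" "u \<in> ?V" "v \<in> ?V" using is_tree_edgeE[OF T] by metis
    show "e \<in> (\<Union>r\<in>R. ?I r) \<union> (\<Union>r\<in>R - {k}. D r)"
    proof (cases "q u = q v")
      case True
      then have "e \<in> ?I (q u)" using e uv by (auto simp: induced_edges_def fiber_def)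
      then show ?thesis using qR uv by blast
    next
      case False
      then have "e \<in> D (if q u = k then q v else q u)"
        using cross[of u v] e uv unfolding D_def by auto
      then show ?thesis using qR uv False cross[of u v] e by (auto split: if_splits)
    qed
  qed (auto simp: induced_edges_def D_def)
  have finI: "finite (?I r)" "finite (D r)" for r
    using finU by (auto simp: induced_edges_def D_def)
  have enonempty: "e \<noteq> {}" if "e \<in> U" for e using is_tree_edgeE[OF T that] by auto
  have c1: "card (\<Union>r\<in>R. ?I r) = (\<Sum>r\<in>R. card (?I r))"
  proof (rule card_UN_disjoint)
    show "\<forall>r\<in>R. \<forall>s\<in>R. r \<noteq> s \<longrightarrow> ?I r \<inter> ?I s = {}"
      using enonempty by (fastforce simp: induced_edges_def fiber_def)
  qed (use finR finI in auto)
  have c2: "card (\<Union>r\<in>R - {k}. D r) = (\<Sum>r\<in>R - {k}. card (D r))"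
  proof (rule card_UN_disjoint)
    show "\<forall>r\<in>R - {k}. \<forall>s\<in>R - {k}. r \<noteq> s \<longrightarrow> D r \<inter> D s = {}"
      by (auto simp: D_def doubleton_eq_iff)
  qed (use finR finI in auto)
  have "(\<Union>r\<in>R. ?I r) \<inter> (\<Union>r\<in>R - {k}. D r) = {}"
  proof -
    have "e \<notin> D s" if "e \<in> ?I r" "s \<noteq> k" for e r s
    proof
      assume "e \<in> D s"
      then have "{s, k} \<subseteq> {r}" using that unfolding D_def induced_edges_def fiber_def by blast
      then show False using that by auto
    qed
    then show ?thesis by blast
  qed
  then have cU: "card U = (\<Sum>r\<in>R. card (?I r)) + (\<Sum>r\<in>R - {k}. card (D r))"
    using c1 c2 U_eq finR finI
    by (subst U_eq, subst card_Un_disjoint) auto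
  have "card ?V = (\<Sum>r\<in>R. card (?F r))"
  proof -
    have "?V = (\<Union>r\<in>R. ?F r)" using qR by (auto simp: fiber_def)
    also have "card \<dots> = (\<Sum>r\<in>R. card (?F r))"
      by (rule card_UN_disjoint) (use finR in \<open>auto simp: fiber_def\<close>)
    finally show ?thesis .
  qed
  also have "\<dots> = (\<Sum>r\<in>R. card (?I r)) + (n + 1)"
    using cardF R by (simp add: sum.distrib[symmetric] sum_Suc)
  finally have "(\<Sum>r\<in>R - {k}. card (D r)) = n"
    using cU is_tree_card[OF T] by simp
  also have "n = (\<Sum>r\<in>R - {k}. 1)" using R kR finR by simp
  finally have sumD: "(\<Sum>r\<in>R - {k}. card (D r)) = (\<Sum>r\<in>R - {k}. 1)" .
  have Dge: "1 \<le> card (D r)" if "r \<in> R - {k}" for r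
    using Dne[OF that] finI(2)[of r] by (simp add: Suc_le_eq card_gt_0_iff)
  have D1: "card (D r0) = 1"
  proof (rule ccontr)
    assume "card (D r0) \<noteq> 1"
    then have "(\<Sum>r\<in>R - {k}. 1) < (\<Sum>r\<in>R - {k}. card (D r))"
      using Dge r0 finR le_neq_implies_less[OF Dge[OF r0]]
      by (intro sum_strict_mono_ex1) auto
    then show False using sumD by simp
  qed
  have r0R: "r0 \<in> R" "r0 \<noteq> k" using r0 by auto
  have finF: "finite (?F r0)" by (simp add: fiber_def)
  have "(\<Sum>v\<in>?F r0. vdegree U v) = (\<Sum>v\<in>?F r0. \<Sum>e\<in>U. if v \<in> e then 1 else 0)"
    unfolding vdegree_def using finU by (simp add: sum.If_cases Int_def)
  also have "\<dots> = (\<Sum>e\<in>U. card (e \<inter> ?F r0))"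
    using finF by (subst sum.swap) (simp add: sum.If_cases Int_def conj_commute)
  also have "\<dots> = (\<Sum>e\<in>?I r0 \<union> D r0. card (e \<inter> ?F r0))"
  proof (rule sum.mono_neutral_right)
    show "?I r0 \<union> D r0 \<subseteq> U" by (auto simp: induced_edges_def D_def)
    show "\<forall>e\<in>U - (?I r0 \<union> D r0). card (e \<inter> ?F r0) = 0"
    proof
      fix e assume e: "e \<in> U - (?I r0 \<union> D r0)"
      then obtain u v where uv: "e = {u, v}" "u \<in> ?V" "v \<in> ?V" using is_tree_edgeE[OF T] by blast
      then have "q u \<noteq> r0" "q v \<noteq> r0"
        using e cross[of u v] r0R unfolding induced_edges_def D_def fiber_def by auto
      then show "card (e \<inter> ?F r0) = 0" using uv by (simp add: fiber_def)
    qed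
  qed (use finU in auto)
  also have "\<dots> = (\<Sum>e\<in>?I r0. card (e \<inter> ?F r0)) + (\<Sum>e\<in>D r0. card (e \<inter> ?F r0))"
  proof (rule sum.union_disjoint)
    show "?I r0 \<inter> D r0 = {}" using r0R by (auto simp: induced_edges_def D_def fiber_def)
  qed (use finI in auto)
  also have "(\<Sum>e\<in>?I r0. card (e \<inter> ?F r0)) = (\<Sum>e\<in>?I r0. 2)"
  proof (rule sum.cong[OF refl])
    fix e assume "e \<in> ?I r0"
    then have "e \<in> U" "e \<inter> ?F r0 = e" by (auto simp: induced_edges_def)
    then show "card (e \<inter> ?F r0) = 2" using T unfolding is_tree_def simple_graph_def by auto
  qed
  also have "(\<Sum>e\<in>D r0. card (e \<inter> ?F r0)) = (\<Sum>e\<in>D r0. 1)"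
  proof (rule sum.cong[OF refl])
    fix e assume e: "e \<in> D r0"
    then have eU: "e \<in> U" and qe: "q ` e = {r0, k}" by (auto simp: D_def)
    obtain u v where uv: "e = {u, v}" "u \<in> ?V" "v \<in> ?V" "u \<noteq> v"
      using is_tree_edgeE[OF T eU] by metis
    have "q u = r0 \<and> q v = k \<or> q u = k \<and> q v = r0"
      using qe r0R unfolding uv(1) by (auto simp: doubleton_eq_iff)
    then have "e \<inter> ?F r0 = {u} \<or> e \<inter> ?F r0 = {v}"
      using uv r0R by (auto simp: fiber_def)
    then show "card (e \<inter> ?F r0) = 1" by auto
  qed
  finally have degsum: "(\<Sum>v\<in>?F r0. vdegree U v) = 2 * card (?I r0) + 1" using D1 by simp
  have "\<exists>v\<in>?F r0. vdegree U v < 2"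
  proof (rule ccontr)
    assume "\<not> ?thesis"
    then have "(\<Sum>v\<in>?F r0. 2) \<le> (\<Sum>v\<in>?F r0. vdegree U v)" by (intro sum_mono) auto
    then show False using degsum cardF[OF r0R(1)] by simp
  qed
  then obtain v where v: "v \<in> ?F r0" "vdegree U v < 2" by blast
  then have vV: "v \<in> ?V" "q v = r0" by (auto simp: fiber_def)
  have "v \<noteq> k" using vV r0R ret kR by metis
  then obtain y where "{v, y} \<in> U" using is_tree_neighbour[OF T vV(1), of k] kR R(1) by blast
  then have "{e \<in> U. v \<in> e} \<noteq> {}" by blast
  then have "vdegree U v > 0" unfolding vdegree_def using finU by (simp add: card_gt_0_iff)
  then have "vdegree U v = 1" using v by simp
  then show ?thesis using vV unfolding leaves_def by auto
qed

lemma finite_leaves [simp]: "finite (leaves k U)" by (simp add: leaves_def)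

lemma has_top_star_iff_leaves:
  assumes U: "U \<in> labeled_trees k" and k: "k \<ge> 1"
  shows "has_top_star n k U \<longleftrightarrow> n \<le> card (leaves k U - {k})"
proof
  assume "n \<le> card (leaves k U - {k})"
  then obtain A where "A \<subseteq> leaves k U - {k}" "card A = n"
    by (meson obtain_subset_with_card_n)
  then show "has_top_star n k U" using has_top_star_if_leaves U k by blast
next
  assume "has_top_star n k U"
  then obtain R q where d: "is_display (n + 1) (star n) k U R q" and last: "survivor R (n + 1) = k"
    unfolding has_top_star_def by blast
  have R: "R \<subseteq> {1..k}" "card R = n + 1" "\<And>r. r \<in> R \<Longrightarrow> q r = r"
    using d unfolding is_display_def by auto
  have finR: "finite R" using R finite_subset by blast
  have "k \<in> R" using bij_betw_survivor[OF finR R(2)] last unfolding bij_betw_def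
    by (metis atLeastAtMost_iff imageI le_add2 order_refl)
  then have "R - {k} \<subseteq> q ` (leaves k U - {k})"
    using star_display_leaf_in_fiber[OF U d last] R(3)[of k] by fastforce
  then have "card (R - {k}) \<le> card (leaves k U - {k})"
    by (meson card_image_le card_mono finite_Diff finite_imageI finite_leaves le_trans)
  then show "n \<le> card (leaves k U - {k})" using R finR \<open>k \<in> R\<close> by simp
qed

section \<open>Counting labeled trees by leaves\<close>

text \<open>Relabeling along a bijection of all of \<open>nat\<close> keeps the inverse total; transpositions are the
  only relabelings that occur below.\<close>

lemma is_tree_image:
  assumes f: "bij f" and T: "is_tree V E"
  shows "is_tree (f ` V) ((`) f ` E)"
proof -
  have inj: "inj f" using f bij_is_inj by blast
  have "simple_graph (f ` V) ((`) f ` E)"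
    using T inj unfolding is_tree_def simple_graph_def
    by (auto simp: card_image inj_on_subset[OF inj])
  moreover have reach: "(f u, f v) \<in> {(x, y). {x, y} \<in> (`) f ` E}\<^sup>*"
    if "(u, v) \<in> {(x, y). {x, y} \<in> E}\<^sup>*" for u v
    using that
  proof (induction rule: rtrancl_induct)
    case (step b c)
    then have "(f b, f c) \<in> {(x, y). {x, y} \<in> (`) f ` E}" by (auto intro: rev_image_eqI)
    with step.IH show ?case by (rule rtrancl_into_rtrancl)
  qed auto
  then have "graph_connected (f ` V) ((`) f ` E)"
    using T unfolding is_tree_def graph_connected_def by auto
  moreover have "\<not> graph_cycle ((`) f ` E) c" for c
  proof
    assume c: "graph_cycle ((`) f ` E) c"
    have "graph_cycle E (map (inv f) c)"
      unfolding graph_cycle_def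
    proof (intro conjI allI impI)
      show "length (map (inv f) c) \<ge> 3" using c unfolding graph_cycle_def by simp
      show "distinct (map (inv f) c)"
        using c f unfolding graph_cycle_def
        by (simp add: distinct_map inj_on_subset[OF bij_is_inj[OF bij_imp_bij_inv]])
      fix i assume i: "i < length (map (inv f) c)"
      then have "{c ! i, c ! (Suc i mod length c)} \<in> (`) f ` E"
        using c unfolding graph_cycle_def by auto
      then obtain e where e: "e \<in> E" "f ` e = {c ! i, c ! (Suc i mod length c)}" by auto
      have "inv f ` f ` e = {inv f (c ! i), inv f (c ! (Suc i mod length c))}"
        unfolding e(2) by simp
      then have "e = {inv f (c ! i), inv f (c ! (Suc i mod length c))}"
        using inj by (simp add: image_image)
      moreover have "Suc i mod length c < length c" using i by (auto intro: mod_less_divisor)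
      ultimately show "{map (inv f) c ! i, map (inv f) c ! (Suc i mod length (map (inv f) c))} \<in> E"
        using i e by simp
    qed
    then show False using T unfolding is_tree_def by blast
  qed
  ultimately show ?thesis unfolding is_tree_def by blast
qed

lemma vdegree_image:
  assumes "bij f"
  shows "vdegree ((`) f ` E) (f v) = vdegree E v"
proof -
  have inj: "inj f" using assms bij_is_inj by blast
  have "{e \<in> (`) f ` E. f v \<in> e} = (`) f ` {e \<in> E. v \<in> e}"
    by (auto dest!: injD[OF inj])
  then show ?thesis
    unfolding vdegree_def using inj by (simp add: card_image inj_on_def inj_image_eq_iff)
qed

lemma leaves_image:
  assumes f: "bij f" and perm: "f ` {1..k} = {1..k}"
  shows "leaves k ((`) f ` E) = f ` leaves k E"
proof -
  have "leaves k ((`) f ` E) = {w \<in> f ` {1..k}. vdegree ((`) f ` E) w = 1}"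
    unfolding leaves_def perm ..
  also have "\<dots> = f ` leaves k E"
    unfolding leaves_def by (auto simp: vdegree_image[OF f] image_iff)
  finally show ?thesis .
qed

lemma finite_labeled_trees [simp]: "finite (labeled_trees k)"
proof (rule finite_subset)
  show "labeled_trees k \<subseteq> Pow (Pow {1..k})"
    unfolding labeled_trees_def is_tree_def simple_graph_def by auto
qed simp

lemma labeled_tree_edge_le:
  assumes "E \<in> labeled_trees k" "e \<in> E" "x \<in> e"
  shows "1 \<le> x" "x \<le> k"
proof -
  have "e \<subseteq> {1..k}" using assms unfolding labeled_trees_def is_tree_def simple_graph_def by simp
  then show "1 \<le> x" "x \<le> k" using assms(3) by auto
qed

definition trees_with_leaves :: "nat \<Rightarrow> nat \<Rightarrow> nat set set set" where
  "trees_with_leaves k L = {E \<in> labeled_trees k. card (leaves k E) = L}"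

lemma finite_trees_with_leaves [simp]: "finite (trees_with_leaves k L)"
  by (simp add: trees_with_leaves_def)

lemma tau_eq_card: "tau k L = card (trees_with_leaves k L)"
  by (simp add: tau_def trees_with_leaves_def)

text \<open>Transposing labels shows that every vertex is a leaf equally often.\<close>

lemma card_trees_leaf_eq:
  assumes v: "v \<in> {1..k}"
  shows "card {E \<in> trees_with_leaves k L. v \<in> leaves k E} =
    card {E \<in> trees_with_leaves k L. k \<in> leaves k E}"
proof -
  define f where "f = Transposition.transpose v k"
  have bij: "bij f" unfolding f_def by simp
  have perm: "f ` {1..k} = {1..k}" unfolding f_def using v by simp
  have ff: "(`) f ` (`) f ` E = E" for E :: "nat set set"
    by (simp add: image_image f_def)
  have fv: "f v = k" "f k = v" by (auto simp: f_def)
  have inj: "inj f" using bij bij_is_inj by blast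
  have tree: "(`) f ` E \<in> trees_with_leaves k L" if "E \<in> trees_with_leaves k L" for E
    using that is_tree_image[OF bij, of "{1..k}" E] leaves_image[OF bij perm, of E] perm
    unfolding trees_with_leaves_def labeled_trees_def
    by (auto simp: card_image inj_on_subset[OF inj])
  have mem: "x \<in> leaves k E \<longleftrightarrow> f x \<in> leaves k ((`) f ` E)" for x E
    using leaves_image[OF bij perm, of E] inj by (simp add: inj_image_mem_iff)
  have "bij_betw ((`) ((`) f)) {E \<in> trees_with_leaves k L. v \<in> leaves k E}
     {E \<in> trees_with_leaves k L. k \<in> leaves k E}"
  proof (rule bij_betw_byWitness[where f' = "(`) ((`) f)"])
    show "(`) ((`) f) ` {E \<in> trees_with_leaves k L. v \<in> leaves k E}
        \<subseteq> {E \<in> trees_with_leaves k L. k \<in> leaves k E}"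
      using tree mem[of v] fv by auto
    show "(`) ((`) f) ` {E \<in> trees_with_leaves k L. k \<in> leaves k E}
        \<subseteq> {E \<in> trees_with_leaves k L. v \<in> leaves k E}"
      using tree mem[of k] fv by auto
  qed (auto simp: ff)
  then show ?thesis by (rule bij_betw_same_card)
qed

text \<open>Both sides count the pairs of a tree and one of its leaves, by symmetry \<open>k\<close> times those whose
  leaf is the top vertex.\<close>

lemma card_trees_top_leaf:
  "k * card {E \<in> trees_with_leaves k L. k \<in> leaves k E} = L * tau k L"
proof -
  have "k * card {E \<in> trees_with_leaves k L. k \<in> leaves k E} =
      (\<Sum>v\<in>{1..k}. card {E \<in> trees_with_leaves k L. v \<in> leaves k E})"
    by (simp only: card_trees_leaf_eq sum_constant card_atLeastAtMost cong: sum.cong) simp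
  also have "\<dots> = (\<Sum>v\<in>{1..k}. \<Sum>E\<in>trees_with_leaves k L. if v \<in> leaves k E then 1 else 0)"
    by (simp add: sum.If_cases Int_def)
  also have "\<dots> = (\<Sum>E\<in>trees_with_leaves k L. \<Sum>v\<in>{1..k}. if v \<in> leaves k E then 1 else 0)"
    by (rule sum.swap)
  also have "\<dots> = (\<Sum>E\<in>trees_with_leaves k L. card (leaves k E))"
  proof (rule sum.cong[OF refl])
    fix E
    have "{1..k} \<inter> {v. v \<in> leaves k E} = leaves k E" by (auto simp: leaves_def)
    then show "(\<Sum>v\<in>{1..k}. if v \<in> leaves k E then 1 else 0) = card (leaves k E)"
      by (simp add: sum.If_cases)
  qed
  also have "\<dots> = L * tau k L" by (simp add: tau_eq_card trees_with_leaves_def)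
  finally show ?thesis .
qed

text \<open>Hanging the new vertex on \<open>u\<close> creates one leaf and destroys one exactly if \<open>u\<close> was a leaf.\<close>

lemma leaves_attach_leaf:
  assumes E: "E \<in> labeled_trees m" and m: "m \<ge> 2" and u: "u \<in> {1..m}"
  shows "insert {u, Suc m} E \<in> labeled_trees (Suc m)"
    and "leaves (Suc m) (insert {u, Suc m} E) = insert (Suc m) (leaves m E - {u})"
proof -
  let ?E = "insert {u, Suc m} E"
  have T: "is_tree {1..m} E" using E unfolding labeled_trees_def by simp
  have set: "insert (Suc m) {1..m} = {1..Suc m}" by auto
  show "?E \<in> labeled_trees (Suc m)"
    using is_tree_attach_leaf[OF T u, of "Suc m"] unfolding labeled_trees_def set by simp
  have new: "Suc m \<notin> e" if "e \<in> E" for e using labeled_tree_edge_le[OF E that] by fastforce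
  have finE: "finite E" using T is_tree_finite_edges by blast
  have "{e \<in> ?E. Suc m \<in> e} = {{u, Suc m}}" using new by auto
  then have deg_new: "vdegree ?E (Suc m) = 1" unfolding vdegree_def by simp
  have deg_other: "vdegree ?E v = vdegree E v" if "v \<noteq> u" "v \<noteq> Suc m" for v
  proof -
    have "{e \<in> ?E. v \<in> e} = {e \<in> E. v \<in> e}" using that by auto
    then show ?thesis unfolding vdegree_def by simp
  qed
  have deg_u: "vdegree ?E u \<noteq> 1"
  proof -
    \<comment> \<open>Some vertex other than \<open>u\<close>; it exists because \<open>m \<ge> 2\<close>, and forces \<open>u\<close> to have an old
      neighbour.\<close>
    define z :: nat where "z = (if u = 1 then 2 else 1)"
    then have "z \<in> {1..m}" "z \<noteq> u" using m by auto
    then obtain y where y: "{u, y} \<in> E" using is_tree_neighbour[OF T u] by blast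
    have "{{u, Suc m}, {u, y}} \<subseteq> {e \<in> ?E. u \<in> e}" using y by auto
    moreover have "{u, Suc m} \<noteq> {u, y}" using new y by auto
    moreover have "finite {e \<in> ?E. u \<in> e}" using finE by simp
    ultimately have "2 \<le> card {e \<in> ?E. u \<in> e}" by (metis card_2_iff card_mono)
    then show ?thesis unfolding vdegree_def by simp
  qed
  show "leaves (Suc m) ?E = insert (Suc m) (leaves m E - {u})"
  proof (intro set_eqI)
    fix v
    show "v \<in> leaves (Suc m) ?E \<longleftrightarrow> v \<in> insert (Suc m) (leaves m E - {u})"
      using deg_new deg_u deg_other[of v] u unfolding leaves_def
      by (cases "v = u"; cases "v = Suc m") auto
  qed
qed

lemma bij_betw_attach_leaf:
  assumes m: "m \<ge> 2"
  shows "bij_betw (\<lambda>(E, u). insert {u, Suc m} E)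
    (SIGMA E:labeled_trees m. {u \<in> {1..m}. card (insert (Suc m) (leaves m E - {u})) = L})
    {E \<in> trees_with_leaves (Suc m) L. Suc m \<in> leaves (Suc m) E}" (is "bij_betw ?f ?A ?B")
  unfolding bij_betw_def
proof
  have new: "Suc m \<notin> e" if "E \<in> labeled_trees m" "e \<in> E" for e E
    using labeled_tree_edge_le[OF that] by fastforce
  show "inj_on ?f ?A"
  proof (rule inj_onI, clarify)
    fix E u E' u'
    assume E: "E \<in> labeled_trees m" "E' \<in> labeled_trees m"
      and eq: "insert {u, Suc m} E = insert {u', Suc m} E'"
    have "E = {e \<in> insert {u, Suc m} E. Suc m \<notin> e}" using new E by auto
    also have "\<dots> = E'" unfolding eq using new E by auto
    finally have "E = E'" .
    moreover have "{u, Suc m} \<in> insert {u', Suc m} E'" using eq by blast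
    then have "{u, Suc m} = {u', Suc m}" using new[OF E(2), of "{u, Suc m}"] by auto
    ultimately show "E = E' \<and> u = u'" by (auto simp: doubleton_eq_iff)
  qed
  show "?f ` ?A = ?B"
  proof (intro equalityI subsetI)
    fix X assume "X \<in> ?f ` ?A"
    then obtain E u where "E \<in> labeled_trees m" "u \<in> {1..m}" "X = insert {u, Suc m} E"
      "card (insert (Suc m) (leaves m E - {u})) = L" by auto
    then show "X \<in> ?B" using leaves_attach_leaf[of E m u] m
      by (simp add: trees_with_leaves_def)
  next
    fix X assume X: "X \<in> ?B"
    then have T: "is_tree {1..Suc m} X" and deg: "vdegree X (Suc m) = 1"
      and L: "card (leaves (Suc m) X) = L"
      unfolding trees_with_leaves_def labeled_trees_def leaves_def by auto
    obtain u where u: "u \<in> {1..Suc m}" "u \<noteq> Suc m" "{e \<in> X. Suc m \<in> e} = {{Suc m, u}}"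
      using vdegree_one_neighbour[OF T deg] by metis
    define E where "E = {e \<in> X. Suc m \<notin> e}"
    have "{1..Suc m} - {Suc m} = {1..m}" by auto
    then have E: "E \<in> labeled_trees m"
      using is_tree_remove_leaf[OF T deg] unfolding labeled_trees_def E_def by simp
    have "X = E \<union> {e \<in> X. Suc m \<in> e}" unfolding E_def by auto
    then have XE: "X = insert {u, Suc m} E" unfolding u(3) by (simp add: insert_commute)
    have u': "u \<in> {1..m}" using u by auto
    then have "(E, u) \<in> ?A"
      using leaves_attach_leaf(2)[OF E m u'] L E unfolding XE by simp
    then show "X \<in> ?f ` ?A" using XE by (auto intro: rev_image_eqI)
  qed
qed

lemma tau_zero:
  assumes "k \<ge> 2"
  shows "tau k 0 = 0"
proof -
  have "leaves k E \<noteq> {}" if "E \<in> labeled_trees k" for E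
  proof -
    have "is_tree {1..k} E" using that unfolding labeled_trees_def by simp
    then obtain v where "v \<in> {1..k}" "vdegree E v = 1"
      using is_tree_has_leaf[of "{1..k}" E] assms by auto
    then show ?thesis unfolding leaves_def by auto
  qed
  moreover have "finite (leaves k E)" for E by (simp add: leaves_def)
  ultimately have "{E \<in> labeled_trees k. card (leaves k E) = 0} = {}" by auto
  then show ?thesis unfolding tau_def by simp
qed

lemma card_leaves_le: "card (leaves k E) \<le> k"
proof -
  have "leaves k E \<subseteq> {1..k}" by (auto simp: leaves_def)
  from card_mono[OF _ this] show ?thesis by simp
qed

lemma tau_eq_0: "L > k \<Longrightarrow> tau k L = 0"
proof -
  assume "L > k"
  then have "card (leaves k E) \<noteq> L" for E using card_leaves_le[of k E] by simp
  then show ?thesis unfolding tau_def by simp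
qed

text \<open>Both sides count the trees on \<open>Suc m\<close> vertices with \<open>Suc L\<close> leaves, one of them marked. By
  symmetry the marked leaf may be taken to be \<open>Suc m\<close>; removing it leaves a smaller tree and the
  vertex it hung on, which is one of \<open>Suc L\<close> leaves or one of \<open>m - L\<close> inner vertices.\<close>

lemma tau_rec:
  assumes m: "m \<ge> 2"
  shows "Suc L * tau (Suc m) (Suc L) =
    Suc m * (Suc L * tau m (Suc L) + (m - L) * tau m L)"
proof -
  have count: "card {u \<in> {1..m}. card (insert (Suc m) (leaves m E - {u})) = Suc L} =
      (if card (leaves m E) = Suc L then Suc L else 0) +
      (if card (leaves m E) = L then m - L else 0)" for E
  proof -
    have sub: "leaves m E \<subseteq> {1..m}" by (auto simp: leaves_def)
    have c: "card (insert (Suc m) (leaves m E - {u})) =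
        (if u \<in> leaves m E then card (leaves m E) else Suc (card (leaves m E)))" for u
    proof -
      have fin: "Suc m \<notin> leaves m E - {u}" "finite (leaves m E)"
        using sub by (auto intro: finite_subset)
      then have "card (insert (Suc m) (leaves m E - {u})) = Suc (card (leaves m E - {u}))" by simp
      then show ?thesis using card_Suc_Diff1[OF fin(2)] by auto
    qed
    consider "card (leaves m E) = Suc L" | "card (leaves m E) = L" |
      "card (leaves m E) \<noteq> Suc L" "card (leaves m E) \<noteq> L" by blast
    then show ?thesis
    proof cases
      case 1
      then have "{u \<in> {1..m}. card (insert (Suc m) (leaves m E - {u})) = Suc L} = leaves m E"
        unfolding c using sub by auto
      then show ?thesis using 1 by simp
    next
      case 2
      then have "{u \<in> {1..m}. card (insert (Suc m) (leaves m E - {u})) = Suc L}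
          = {1..m} - leaves m E"
        unfolding c using sub by auto
      then show ?thesis using 2 sub by (simp add: card_Diff_subset finite_subset[OF sub])
    next
      case 3
      then have "{u \<in> {1..m}. card (insert (Suc m) (leaves m E - {u})) = Suc L} = {}"
        unfolding c by auto
      then show ?thesis using 3 by simp
    qed
  qed
  have "card {E \<in> trees_with_leaves (Suc m) (Suc L). Suc m \<in> leaves (Suc m) E} =
      (\<Sum>E\<in>labeled_trees m.
        card {u \<in> {1..m}. card (insert (Suc m) (leaves m E - {u})) = Suc L})"
    using bij_betw_same_card[OF bij_betw_attach_leaf[OF m, of "Suc L"]] by (simp add: card_SigmaI)
  also have "\<dots> = (\<Sum>E\<in>labeled_trees m. if card (leaves m E) = Suc L then Suc L else 0) +
      (\<Sum>E\<in>labeled_trees m. if card (leaves m E) = L then m - L else 0)"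
    unfolding count by (simp only: sum.distrib)
  also have "\<dots> = Suc L * tau m (Suc L) + (m - L) * tau m L"
    by (simp add: sum.If_cases tau_def Int_def)
  finally show ?thesis using card_trees_top_leaf[of "Suc m" "Suc L"] by simp
qed

lemma labeled_trees_2: "labeled_trees 2 = {{{1, 2}}}"
proof (intro equalityI subsetI)
  have set: "{1..2} = {1, 2::nat}" by auto
  fix E assume "E \<in> labeled_trees 2"
  then have T: "is_tree {1..2} E" unfolding labeled_trees_def by simp
  have 1: "e = {1, 2}" if "e \<in> E" for e
    using is_tree_edgeE[OF T that] unfolding set by (metis doubleton_eq_iff empty_iff insert_iff)
  moreover have "E \<noteq> {}" using is_tree_neighbour[OF T, of 1 2] by auto
  ultimately show "E \<in> {{{1, 2}}}" by blast
next
  have "is_tree {2, 1} {{1, 2::nat}}"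
    using is_tree_attach_leaf[OF is_tree_singleton, of 1 1 2] by simp
  moreover have "{1..2} = {2, 1::nat}" by auto
  moreover fix E :: "nat set set" assume "E \<in> {{{1, 2}}}"
  ultimately show "E \<in> labeled_trees 2" unfolding labeled_trees_def by simp
qed

lemma tau_2: "tau 2 L = (if L = 2 then 1 else 0)"
proof -
  have "vdegree {{1, 2}} v = 1" if "v \<in> {1, 2::nat}" for v
  proof -
    have "{e \<in> {{1, 2::nat}}. v \<in> e} = {{1, 2}}" using that by auto
    then show ?thesis unfolding vdegree_def by simp
  qed
  moreover have "{1..2} = {1, 2::nat}" by auto
  ultimately have "leaves 2 {{1, 2}} = {1..2}" unfolding leaves_def by blast
  then have "{E \<in> labeled_trees 2. card (leaves 2 E) = L} = (if L = 2 then {{{1, 2}}} else {})"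
    unfolding labeled_trees_2 by auto
  then show ?thesis unfolding tau_def by simp
qed

text \<open>After multiplication by \<open>fact L\<close> and division by \<open>fact (m + 2)\<close>, the recurrence for \<open>tau\<close> is
  the one for Stirling numbers of the second kind.\<close>

lemma tau_Stirling:
  "fact L * tau (m + 2) L = (if L \<le> m + 2 then fact (m + 2) * Stirling m (m + 2 - L) else 0)"
proof (induction m arbitrary: L)
  case 0
  consider "L = 0" | "L = 1" | "L = 2" | "L > 2" by linarith
  then show ?case by cases (auto simp: tau_2[unfolded numeral_2_eq_2] numeral_2_eq_2)
next
  case (Suc m)
  show ?case
  proof (cases L)
    case 0
    then show ?thesis using tau_zero[of "Suc m + 2"] by simp
  next
    case (Suc l)
    have "fact (Suc l) * tau (Suc m + 2) (Suc l) =
        fact l * (Suc l * tau (Suc (m + 2)) (Suc l))" by (simp add: algebra_simps)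
    also have "\<dots> = Suc (m + 2) *
        (fact (Suc l) * tau (m + 2) (Suc l) + (m + 2 - l) * (fact l * tau (m + 2) l))"
      by (subst tau_rec) (simp_all add: algebra_simps)
    also have "\<dots> = (if Suc l \<le> Suc m + 2 then
        fact (Suc m + 2) * Stirling (Suc m) (Suc m + 2 - Suc l) else 0)"
    proof -
      consider j where "m + 2 = l + Suc j" | "l = m + 2" | "l > m + 2"
        by (metis add_Suc_right less_imp_Suc_add linorder_neqE_nat)
      then show ?thesis
      proof cases
        case 1
        then have "m + 2 - l = Suc j" "m + 2 - Suc l = j" "Suc m + 2 - Suc l = Suc j"
          "l \<le> m + 2" "Suc l \<le> m + 2" by auto
        then show ?thesis unfolding Suc.IH by (simp add: algebra_simps)
      qed (simp_all add: Suc.IH tau_eq_0)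
    qed
    finally show ?thesis using Suc by simp
  qed
qed

section \<open>Trees without a top-centered star display\<close>

text \<open>With \<open>n\<close> or more leaves other than the top vertex a display exists, so the exceptions have
  fewer than \<open>n\<close> leaves, or exactly \<open>n\<close> of them with the top vertex among them.\<close>

lemma A_top_eq_tau:
  assumes k: "k \<ge> 1"
  shows "k * A_top n k = k * (\<Sum>L<n. tau k L) + n * tau k n"
proof -
  let ?top = "{E \<in> trees_with_leaves k n. k \<in> leaves k E}"
  have "has_top_star n k U \<longleftrightarrow>
      \<not> (card (leaves k U) < n \<or> card (leaves k U) = n \<and> k \<in> leaves k U)"
    if U: "U \<in> labeled_trees k" for U
  proof (cases "k \<in> leaves k U")
    case True
    then have "card (leaves k U) = Suc (card (leaves k U - {k}))"
      by (rule card.remove[OF finite_leaves])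
    then show ?thesis using True has_top_star_iff_leaves[OF U k, of n] by linarith
  next
    case False
    then show ?thesis using has_top_star_iff_leaves[OF U k, of n] by auto
  qed
  then have "{U \<in> labeled_trees k. \<not> has_top_star n k U} =
      (\<Union>L\<in>{..<n}. trees_with_leaves k L) \<union> ?top"
    unfolding trees_with_leaves_def by auto
  then have "A_top n k = card ((\<Union>L\<in>{..<n}. trees_with_leaves k L) \<union> ?top)"
    unfolding A_top_def by simp
  also have "\<dots> = card (\<Union>L\<in>{..<n}. trees_with_leaves k L) + card ?top"
    by (rule card_Un_disjoint) (auto simp: trees_with_leaves_def)
  also have "card (\<Union>L\<in>{..<n}. trees_with_leaves k L) = (\<Sum>L<n. tau k L)"
    unfolding tau_eq_card by (rule card_UN_disjoint) (auto simp: trees_with_leaves_def)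
  finally show ?thesis using card_trees_top_leaf[of k n] by (simp add: algebra_simps)
qed

lemma A_top_eq_tau_field:
  assumes "k \<ge> 1"
  shows "(of_nat (A_top n k) :: 'a :: field_char_0) =
    (\<Sum>L<n. of_nat (tau k L)) + of_nat n / of_nat k * of_nat (tau k n)"
proof -
  have "of_nat (k * A_top n k) = (of_nat (k * (\<Sum>L<n. tau k L) + n * tau k n) :: 'a)"
    using A_top_eq_tau[OF assms] by simp
  then show ?thesis using assms by (simp add: field_simps)
qed

lemma A_top_series_eq:
  "A_top_series n = (\<Sum>L<n. T_series L) + of_nat n * fps_integral0 (T_series n / fps_X)"
proof (rule fps_ext)
  fix k
  have shift: "(of_nat n * fps_integral0 (T_series n / fps_X)) $ k =
      of_nat n * (if k = 0 then 0 else T_series n $ k / of_nat k)"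
    by (simp add: fps_of_nat[symmetric] fps_integral_def field_simps del: fps_of_nat)
  show "A_top_series n $ k =
      ((\<Sum>L<n. T_series L) + of_nat n * fps_integral0 (T_series n / fps_X)) $ k"
  proof (cases "k \<ge> 2")
    case True
    then have "A_top_series n $ k = of_nat (A_top n k) / fact k"
      by (simp add: A_top_series_def)
    also have "\<dots> = (\<Sum>L<n. of_nat (tau k L) / fact k) +
        of_nat n * (of_nat (tau k n) / fact k / of_nat k)"
      using A_top_eq_tau_field[of k n, where 'a = rat] True
      by (simp add: add_divide_distrib sum_divide_distrib mult.commute)
    finally show ?thesis unfolding fps_add_nth fps_sum_nth shift using True
      by (simp add: T_series_def)
  next
    case False
    then show ?thesis unfolding fps_add_nth fps_sum_nth shift
      by (simp add: T_series_def A_top_series_def)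
  qed
qed

section \<open>Leaf numbers as polynomials\<close>

lemma coeff_linear_power_pred:
  "coeff ([:1, 1:] ^ Suc d) d = (of_nat (Suc d) :: 'a :: field_char_0)"
proof (induction d)
  case (Suc d)
  have "coeff ([:1, 1::'a:] ^ Suc (Suc d)) (Suc d) =
      coeff ([:1, 1:] ^ Suc d) (Suc d) + coeff ([:1, 1:] ^ Suc d) d"
  proof -
    have "coeff ([:1, 1:] * X) (Suc d) = coeff X (Suc d) + coeff X d" for X :: "'a poly"
      by simp
    then show ?thesis by (subst power_Suc)
  qed
  also have "\<dots> = 1 + of_nat (Suc d)"
    unfolding Suc by (simp only: coeff_linear_power)
  finally show ?case by simp
qed simp

text \<open>Up to lower order, \<open>x ^ Suc d\<close> has the forward difference \<open>Suc d * x ^ d\<close>; this removes the leading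
  term of \<open>q\<close>, and induction on the degree does the rest.\<close>

lemma poly_antidifference:
  fixes q :: "'a :: field_char_0 poly"
  assumes "degree q \<le> d"
  shows "\<exists>p. degree p \<le> Suc d \<and> coeff p (Suc d) = coeff q d / of_nat (Suc d) \<and>
    (\<forall>x. poly p (x + 1) - poly p x = poly q x)"
  using assms
proof (induction d arbitrary: q)
  case 0
  then obtain c where "q = [:c:]" by (metis degree_0_id le_zero_eq)
  then show ?case by (intro exI[of _ "[:0, c:]"]) (auto simp: algebra_simps)
next
  case (Suc d)
  let ?D = "Suc d"
  define c where "c = coeff q ?D / of_nat (Suc ?D)"
  define r where "r = smult c ([:1, 1:] ^ Suc ?D - monom 1 (Suc ?D))"
  have pr: "poly r x = poly (monom c (Suc ?D)) (x + 1) - poly (monom c (Suc ?D)) x" for x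
    by (simp add: r_def poly_monom algebra_simps)
  have "coeff r (Suc ?D) = 0" unfolding r_def by (simp add: coeff_linear_power del: power_Suc)
  moreover have "degree r \<le> Suc ?D" unfolding r_def
    by (rule order.trans[OF degree_smult_le] degree_diff_le)+
       (simp_all add: degree_linear_power degree_monom_le del: power_Suc)
  ultimately have "degree r \<le> ?D" using coeff_0_degree_minus_1[of r "Suc ?D"] by simp
  moreover have "coeff r ?D = coeff q ?D"
    unfolding r_def c_def by (simp add: coeff_linear_power_pred del: power_Suc of_nat_Suc)
  ultimately have "coeff (q - r) ?D = 0" "degree (q - r) \<le> ?D"
    using Suc.prems by (auto intro: degree_diff_le)
  then have "degree (q - r) \<le> d" using coeff_0_degree_minus_1[of "q - r" ?D] by simp
  then obtain p where p: "degree p \<le> ?D" "\<And>x. poly p (x + 1) - poly p x = poly (q - r) x"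
    using Suc.IH by blast
  show ?case
  proof (intro exI[of _ "monom c (Suc ?D) + p"] conjI allI)
    show "degree (monom c (Suc ?D) + p) \<le> Suc ?D"
      using p by (intro degree_add_le) (auto simp: degree_monom_le)
    have "coeff p (Suc ?D) = 0" using p by (intro coeff_eq_0) simp
    then show "coeff (monom c (Suc ?D) + p) (Suc ?D) = coeff q ?D / of_nat (Suc ?D)"
      by (simp add: c_def)
    fix x
    have "poly (monom c (Suc ?D)) (x + 1) - poly (monom c (Suc ?D)) x = poly r x" by (simp add: pr)
    then show "poly (monom c (Suc ?D) + p) (x + 1) - poly (monom c (Suc ?D) + p) x = poly q x"
      using p(2)[of x] by (simp add: algebra_simps)
  qed
qed

text \<open>Write \<open>S\<close> for the Stirling numbers. Their recurrence becomes
  \<open>S (Suc m) (m - l) - S m (m - Suc l) = (m - l) * S m (m - l)\<close>, so each further diagonal is a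
  discrete antiderivative of a polynomial in \<open>m\<close> whose degree is larger by one.\<close>

lemma Stirling_diagonal_poly:
  "\<exists>p :: 'a :: field_char_0 poly. degree p \<le> 2 * l \<and> coeff p (2 * l) = 1 / (2 ^ l * fact l) \<and>
    (\<forall>m. poly p (of_nat m) = (if l \<le> m then of_nat (Stirling m (m - l)) else 0))"
proof (induction l)
  case 0
  show ?case by (intro exI[of _ 1]) auto
next
  case (Suc l)
  then obtain p :: "'a poly" where p: "degree p \<le> 2 * l" "coeff p (2 * l) = 1 / (2 ^ l * fact l)"
    "\<And>m. poly p (of_nat m) = (if l \<le> m then of_nat (Stirling m (m - l)) else 0)" by blast
  define q where "q = [:- of_nat l, 1:] * p"
  have "degree q \<le> Suc (2 * l)" unfolding q_def
    using p(1) degree_mult_le[of "[:- of_nat l, 1:]" p] by simp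
  from poly_antidifference[OF this]
  obtain P where P: "degree P \<le> Suc (Suc (2 * l))"
    "coeff P (Suc (Suc (2 * l))) = coeff q (Suc (2 * l)) / of_nat (Suc (Suc (2 * l)))"
    "\<And>x. poly P (x + 1) - poly P x = poly q x" by blast
  have "coeff p (Suc (2 * l)) = 0" using p(1) by (intro coeff_eq_0) simp
  then have cq: "coeff q (Suc (2 * l)) = 1 / (2 ^ l * fact l)"
    unfolding q_def using p(2) by simp
  \<comment> \<open>The antiderivative is normalized to vanish at \<open>m = 0\<close>, which lies below the
    diagonal.\<close>
  define R where "R = P - [:poly P 0:]"
  have rec: "poly R (of_nat (Suc m)) = poly R (of_nat m) + (of_nat m - of_nat l) * poly p (of_nat m)"
    for m using P(3)[of "of_nat m"] by (simp add: R_def q_def algebra_simps)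
  show ?case
  proof (intro exI[of _ R] conjI allI)
    show "degree R \<le> 2 * Suc l" unfolding R_def using P(1) by (intro degree_diff_le) auto
    have "coeff R (2 * Suc l) = coeff P (Suc (Suc (2 * l)))" by (simp add: R_def)
    also have "\<dots> = 1 / (2 ^ l * fact l) / of_nat (Suc (Suc (2 * l)))"
      unfolding P(2) cq ..
    also have "\<dots> = 1 / (2 ^ Suc l * fact (Suc l))"
      by (simp add: field_simps)
    finally show "coeff R (2 * Suc l) = 1 / (2 ^ Suc l * fact (Suc l))" .
    show "poly R (of_nat m) = (if Suc l \<le> m then of_nat (Stirling m (m - Suc l)) else 0)" for m
    proof (induction m)
      case 0
      show ?case by (simp add: R_def)
    next
      case (Suc m)
      show ?case
      proof (cases "l < m")
        case True
        then obtain j where j: "m = l + Suc j" by (metis less_imp_Suc_add add_Suc_right)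
        then show ?thesis unfolding rec Suc p(3) by (simp add: algebra_simps)
      next
        case False
        then show ?thesis unfolding rec Suc p(3) by (cases "l = m") auto
      qed
    qed
  qed
qed

lemma tau_less_2:
  assumes "k \<ge> 2" "L < 2"
  shows "tau k L = 0"
proof -
  obtain m where m: "k = m + 2" using assms(1) that[of "k - 2"] by simp
  have "L = 0 \<or> L = 1" using assms(2) by linarith
  then have "Stirling m (m + 2 - L) = 0" by auto
  then show ?thesis using tau_Stirling[of L m] m by (simp split: if_splits)
qed

lemma tau_poly:
  assumes L: "L \<ge> 2"
  obtains p :: "'a :: field_char_0 poly" where "degree p \<le> 2 * (L - 2)"
    "coeff p (2 * (L - 2)) = 1 / (2 ^ (L - 2) * fact (L - 2))"
    "\<And>k. k \<ge> 2 \<Longrightarrow> of_nat (tau k L) = fact k / fact L * poly p (of_nat (k - 2))"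
proof -
  obtain p :: "'a poly" where p: "degree p \<le> 2 * (L - 2)"
    "coeff p (2 * (L - 2)) = 1 / (2 ^ (L - 2) * fact (L - 2))"
    "\<And>m. poly p (of_nat m) = (if L - 2 \<le> m then of_nat (Stirling m (m - (L - 2))) else 0)"
    using Stirling_diagonal_poly[of "L - 2"] by blast
  have "of_nat (tau k L) = fact k / fact L * poly p (of_nat (k - 2))" if k: "k \<ge> 2" for k
  proof -
    obtain m where m: "k = m + 2" using k that[of "k - 2"] by simp
    have "of_nat (fact L * tau k L) =
        (of_nat (if L \<le> m + 2 then fact (m + 2) * Stirling m (m + 2 - L) else 0) :: 'a)"
      using tau_Stirling[of L m] m by simp
    also have "\<dots> = fact k * poly p (of_nat m)"
    proof -
      show ?thesis
      proof (cases "L \<le> m + 2")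
        case True
        then have "L - 2 \<le> m" "m + 2 - L = m - (L - 2)" using L by auto
        then show ?thesis
          by (simp only: True if_True of_nat_mult of_nat_fact p(3) m)
      next
        case False
        then have "\<not> L - 2 \<le> m" by auto
        then show ?thesis by (simp only: False if_False of_nat_0 p(3) mult_zero_right)
      qed
    qed
    finally show ?thesis using m by (simp add: field_simps)
  qed
  then show thesis using that p by blast
qed

section \<open>Rationality of the generating function\<close>

text \<open>A denominator with nonzero constant term is a unit among the power series, so the equation
  says \<open>f = P / Q\<close> without a case distinction on division.\<close>

definition rational_fps :: "'a :: field fps \<Rightarrow> bool" where
  "rational_fps f \<longleftrightarrow> (\<exists>P Q. coeff Q 0 \<noteq> 0 \<and> f * fps_of_poly Q = fps_of_poly P)"

lemma rational_fps_divide: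
  assumes "rational_fps f"
  obtains P Q where "coeff Q 0 \<noteq> 0" "f = fps_of_poly P / fps_of_poly Q"
proof -
  obtain P Q where PQ: "coeff Q 0 \<noteq> 0" "f * fps_of_poly Q = fps_of_poly P"
    using assms unfolding rational_fps_def by blast
  have nz: "fps_of_poly Q \<noteq> 0" using PQ(1) by (metis fps_of_poly_nth fps_zero_nth)
  have "f = f * fps_of_poly Q / fps_of_poly Q" using nz by simp
  then show thesis using PQ that by metis
qed

lemma rational_fps_of_poly: "rational_fps (fps_of_poly P)"
  unfolding rational_fps_def by (intro exI[of _ P] exI[of _ 1]) simp

lemma rational_fps_add:
  assumes "rational_fps f" "rational_fps g"
  shows "rational_fps (f + g)"
proof -
  obtain P Q where 1: "coeff Q 0 \<noteq> 0" "f * fps_of_poly Q = fps_of_poly P"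
    using assms(1) unfolding rational_fps_def by blast
  obtain P' Q' where 2: "coeff Q' 0 \<noteq> 0" "g * fps_of_poly Q' = fps_of_poly P'"
    using assms(2) unfolding rational_fps_def by blast
  have "(f + g) * fps_of_poly (Q * Q') =
      f * fps_of_poly Q * fps_of_poly Q' + g * fps_of_poly Q' * fps_of_poly Q"
    by (simp add: fps_of_poly_mult algebra_simps)
  also have "\<dots> = fps_of_poly (P * Q' + P' * Q)"
    unfolding 1 2 by (simp add: fps_of_poly_mult fps_of_poly_add)
  finally show ?thesis unfolding rational_fps_def using 1 2
    by (intro exI[of _ "P * Q' + P' * Q"] exI[of _ "Q * Q'"]) (auto simp: coeff_mult_0)
qed

lemma rational_fps_mult:
  assumes "rational_fps f" "rational_fps g"
  shows "rational_fps (f * g)"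
proof -
  obtain P Q where 1: "coeff Q 0 \<noteq> 0" "f * fps_of_poly Q = fps_of_poly P"
    using assms(1) unfolding rational_fps_def by blast
  obtain P' Q' where 2: "coeff Q' 0 \<noteq> 0" "g * fps_of_poly Q' = fps_of_poly P'"
    using assms(2) unfolding rational_fps_def by blast
  have "f * g * fps_of_poly (Q * Q') = (f * fps_of_poly Q) * (g * fps_of_poly Q')"
    by (simp add: fps_of_poly_mult algebra_simps)
  also have "\<dots> = fps_of_poly (P * P')" unfolding 1 2 by (simp add: fps_of_poly_mult)
  finally show ?thesis unfolding rational_fps_def using 1 2
    by (intro exI[of _ "P * P'"] exI[of _ "Q * Q'"]) (auto simp: coeff_mult_0)
qed

lemma rational_fps_deriv:
  assumes "rational_fps f"
  shows "rational_fps (fps_deriv f)"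
proof -
  obtain P Q where 1: "coeff Q 0 \<noteq> 0" "f * fps_of_poly Q = fps_of_poly P"
    using assms(1) unfolding rational_fps_def by blast
  have eq: "fps_deriv f * fps_of_poly Q + f * fps_of_poly (pderiv Q) = fps_of_poly (pderiv P)"
    using arg_cong[OF 1(2), of fps_deriv] by (simp add: fps_of_poly_pderiv algebra_simps)
  have "fps_deriv f * fps_of_poly (Q * Q) =
      fps_of_poly Q * fps_of_poly (pderiv P) - (f * fps_of_poly Q) * fps_of_poly (pderiv Q)"
    unfolding eq[symmetric] by (simp add: fps_of_poly_mult algebra_simps)
  also have "\<dots> = fps_of_poly (Q * pderiv P - P * pderiv Q)"
    unfolding 1 by (simp add: fps_of_poly_mult fps_of_poly_diff)
  finally show ?thesis unfolding rational_fps_def using 1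
    by (intro exI[of _ "Q * pderiv P - P * pderiv Q"] exI[of _ "Q * Q"]) (auto simp: coeff_mult_0)
qed

text \<open>Multiplying the \<open>k\<close>-th coefficient by \<open>k\<close> is the operator \<open>X * d/dX\<close>, so Horner's scheme builds
  the series from the geometric series by operations that preserve rationality.\<close>

lemma rational_fps_poly_coeffs:
  fixes p :: "'a :: field_char_0 poly"
  shows "rational_fps (Abs_fps (\<lambda>k. poly p (of_nat k)))"
proof (induction p)
  case 0
  show ?case using rational_fps_of_poly[of 0] by (simp add: fps_zero_def)
next
  case (pCons a p)
  have "Abs_fps (\<lambda>_. 1 :: 'a) * fps_of_poly [:1, -1:] = fps_of_poly 1"
  proof (rule fps_ext)
    fix k
    show "(Abs_fps (\<lambda>_. 1 :: 'a) * fps_of_poly [:1, -1:]) $ k = fps_of_poly 1 $ k"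
      by (cases k) (simp_all add: fps_of_poly_linear' algebra_simps flip: fps_const_neg)
  qed
  then have geom: "rational_fps (Abs_fps (\<lambda>_. 1 :: 'a))"
    unfolding rational_fps_def by (intro exI[of _ 1] exI[of _ "[:1, -1:]"]) simp
  have eq: "Abs_fps (\<lambda>k. poly (pCons a p) (of_nat k)) = fps_of_poly [:a:] * Abs_fps (\<lambda>_. 1) +
      fps_of_poly [:0, 1:] * fps_deriv (Abs_fps (\<lambda>k. poly p (of_nat k)))"
  proof (rule fps_ext)
    fix k
    show "Abs_fps (\<lambda>k. poly (pCons a p) (of_nat k)) $ k = (fps_of_poly [:a:] * Abs_fps (\<lambda>_. 1) +
      fps_of_poly [:0, 1:] * fps_deriv (Abs_fps (\<lambda>k. poly p (of_nat k)))) $ k"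
      by (cases k) (simp_all add: fps_of_poly_const)
  qed
  show ?case unfolding eq
    by (intro rational_fps_add rational_fps_mult rational_fps_of_poly rational_fps_deriv geom pCons.IH)
qed

lemma rational_fps_eventually:
  assumes f: "rational_fps f" and eq: "\<And>k. k \<ge> m \<Longrightarrow> fps_nth g k = fps_nth f k"
  shows "rational_fps g"
proof -
  have "g = f + fps_cutoff m (g - f)" by (rule fps_ext) (simp add: eq)
  then have "g = f + fps_of_poly (truncate_fps m (g - f))" by simp
  then show ?thesis using rational_fps_add[OF f rational_fps_of_poly] by metis
qed

lemma log_one_minus_nth: "log_one_minus $ k = - 1 / of_nat k"
proof -
  have sq: "(- 1 :: rat) ^ m * (- 1) ^ m = 1" for m by (simp flip: power_mult_distrib)
  have "log_one_minus $ k = (-1) ^ k * fps_ln 1 $ k"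
    unfolding log_one_minus_def by (simp add: fps_compose_uminus')
  then show ?thesis by (cases k) (simp_all add: fps_ln_nth sq del: of_nat_Suc)
qed

text \<open>Dividing the polynomial behind \<open>tau k n / fact k\<close> by \<open>k\<close> leaves a polynomial and a multiple
  of \<open>1 / k\<close>; the latter is the logarithm.\<close>

lemma A_top_series_rational_log:
  "\<exists>(P :: rat poly) Q \<gamma>. coeff Q 0 \<noteq> 0 \<and>
    A_top_series n = fps_of_poly P / fps_of_poly Q - fps_const \<gamma> * log_one_minus"
proof -
  have "\<exists>p :: rat poly. \<forall>k\<ge>2. of_nat (tau k L) / fact k = poly p (of_nat k)" for L
  proof (cases "L < 2")
    case True
    then show ?thesis by (intro exI[of _ 0]) (simp add: tau_less_2)
  next
    case False
    then obtain p :: "rat poly" where p: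
      "\<And>k. k \<ge> 2 \<Longrightarrow> of_nat (tau k L) = fact k / fact L * poly p (of_nat (k - 2))"
      using tau_poly[of L] by (metis not_le)
    show ?thesis
    proof (intro exI[of _ "smult (1 / fact L) (pcompose p [:-2, 1:])"] allI impI)
      fix k :: nat assume "k \<ge> 2"
      then show "of_nat (tau k L) / fact k =
          poly (smult (1 / fact L) (pcompose p [:-2, 1:])) (of_nat k)"
        using p[of k] by (simp add: poly_pcompose of_nat_diff)
    qed
  qed
  then obtain p :: "nat \<Rightarrow> rat poly" where
    p: "\<And>L k. k \<ge> 2 \<Longrightarrow> of_nat (tau k L) / fact k = poly (p L) (of_nat k)" by metis
  obtain c q where cq: "p n = pCons c q" by (rule pCons_cases)
  define \<gamma> where "\<gamma> = of_nat n * c"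
  have "rational_fps (A_top_series n + fps_const \<gamma> * log_one_minus)"
  proof (rule rational_fps_eventually)
    show "rational_fps (Abs_fps (\<lambda>k. poly ((\<Sum>L<n. p L) + smult (of_nat n) q) (of_nat k)))"
      by (rule rational_fps_poly_coeffs)
    fix k :: nat assume k: "k \<ge> 2"
    have "of_nat (A_top n k) / fact k =
        (\<Sum>L<n. of_nat (tau k L) / fact k) + of_nat n / of_nat k * (of_nat (tau k n) / (fact k :: rat))"
      using A_top_eq_tau_field[of k n, where 'a = rat] k
      by (simp add: add_divide_distrib sum_divide_distrib)
    also have "\<dots> = poly (\<Sum>L<n. p L) (of_nat k) + \<gamma> / of_nat k + of_nat n * poly q (of_nat k)"
      using k by (simp add: p cq \<gamma>_def poly_sum field_simps)
    finally show "(A_top_series n + fps_const \<gamma> * log_one_minus) $ k =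
        Abs_fps (\<lambda>k. poly ((\<Sum>L<n. p L) + smult (of_nat n) q) (of_nat k)) $ k"
      using k by (simp add: A_top_series_def log_one_minus_nth)
  qed
  then obtain P Q where PQ: "coeff Q 0 \<noteq> 0"
    "A_top_series n + fps_const \<gamma> * log_one_minus = fps_of_poly P / fps_of_poly Q"
    by (rule rational_fps_divide)
  show ?thesis
    by (intro exI[of _ P] exI[of _ Q] exI[of _ \<gamma>])
       (use PQ in \<open>auto simp: eq_diff_eq\<close>)
qed

section \<open>Asymptotics for a fixed number of leaves\<close>

lemma tendsto_poly_div_power:
  assumes "degree p \<le> d"
  shows "(\<lambda>m. poly p (real m) / real m ^ d) \<longlonglongrightarrow> coeff p d"
proof -
  have summand: "(\<lambda>m. coeff p i * (real m ^ i / real m ^ d)) \<longlonglongrightarrow> (if i = d then coeff p d else 0)"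
    if i: "i \<le> d" for i
  proof (cases "i = d")
    case True
    have "(\<lambda>m. coeff p i * (real m ^ i / real m ^ d)) \<longlonglongrightarrow> coeff p i * 1"
    proof (intro tendsto_mult tendsto_const tendsto_eventually)
      show "\<forall>\<^sub>F m in sequentially. real m ^ i / real m ^ d = 1"
        using eventually_gt_at_top[of 0] by eventually_elim (simp add: True)
    qed
    then show ?thesis using True by simp
  next
    case False
    have "(\<lambda>m. inverse (real m) ^ (d - i)) \<longlonglongrightarrow> 0 ^ (d - i)"
      by (intro tendsto_power lim_inverse_n)
    moreover have "\<forall>\<^sub>F m in sequentially. inverse (real m) ^ (d - i) = real m ^ i / real m ^ d"
      using eventually_gt_at_top[of 0]
    proof eventually_elim
      case (elim m)
      have "real m ^ d = real m ^ i * real m ^ (d - i)" using i by (simp flip: power_add)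
      then show ?case using elim by (simp add: power_inverse field_simps)
    qed
    ultimately have "(\<lambda>m. real m ^ i / real m ^ d) \<longlonglongrightarrow> 0"
      using False i by (simp add: zero_power tendsto_cong)
    from tendsto_mult_right_zero[OF this, of "coeff p i"] show ?thesis using False by simp
  qed
  have "poly p x / x ^ d = (\<Sum>i\<le>d. coeff p i * (x ^ i / x ^ d))" for x :: real
  proof -
    have "poly p x = (\<Sum>i\<le>d. coeff p i * x ^ i)"
      unfolding poly_altdef using assms
      by (intro sum.mono_neutral_left) (auto simp: coeff_eq_0)
    then show ?thesis by (simp add: sum_divide_distrib)
  qed
  moreover have "(\<lambda>m. \<Sum>i\<le>d. coeff p i * (real m ^ i / real m ^ d)) \<longlonglongrightarrow>
      (\<Sum>i\<le>d. if i = d then coeff p d else 0)"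
    by (intro tendsto_sum summand) simp
  ultimately show ?thesis by (simp add: sum.delta)
qed

lemma tau_asymp:
  assumes L: "L \<ge> 2"
  shows "(\<lambda>k. real (tau k L) / (fact k * real k ^ (2 * (L - 2)))) \<longlonglongrightarrow>
    1 / (2 ^ (L - 2) * fact (L - 2) * fact L)"
proof -
  let ?d = "2 * (L - 2)"
  obtain p :: "real poly" where p: "degree p \<le> ?d" "coeff p ?d = 1 / (2 ^ (L - 2) * fact (L - 2))"
    "\<And>k. k \<ge> 2 \<Longrightarrow> real (tau k L) = fact k / fact L * poly p (real (k - 2))"
    using tau_poly[OF L] by blast
  have "(\<lambda>k. poly p (real (k - 2)) / real (k - 2) ^ ?d) \<longlonglongrightarrow> coeff p ?d"
    using filterlim_compose[OF tendsto_poly_div_power[OF p(1)] filterlim_minus_const_nat_at_top] .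
  \<comment> \<open>This factor converts the normalization from \<open>(k - 2) ^ d\<close> to \<open>k ^ d\<close>.\<close>
  moreover have "(\<lambda>k. (1 - 2 * inverse (real k)) ^ ?d) \<longlonglongrightarrow> (1 - 2 * 0) ^ ?d"
    by (intro tendsto_intros lim_inverse_n)
  ultimately have "(\<lambda>k. poly p (real (k - 2)) / real (k - 2) ^ ?d *
      (1 - 2 * inverse (real k)) ^ ?d / fact L) \<longlonglongrightarrow> coeff p ?d * (1 - 2 * 0) ^ ?d / fact L"
    by (intro tendsto_divide tendsto_mult tendsto_const) auto
  moreover have "\<forall>\<^sub>F k in sequentially. poly p (real (k - 2)) / real (k - 2) ^ ?d *
      (1 - 2 * inverse (real k)) ^ ?d / fact L = real (tau k L) / (fact k * real k ^ ?d)"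
    using eventually_gt_at_top[of 2]
  proof eventually_elim
    case (elim k)
    have "1 - 2 * inverse (real k) = real (k - 2) / real k"
      using elim by (simp add: field_simps of_nat_diff)
    then show ?case using elim p(3)[of k] by (simp add: power_divide)
  qed
  ultimately show ?thesis using p(2) by (simp add: tendsto_cong mult.commute)
qed

text \<open>By \<open>tau_asymp\<close> the term with \<open>L \<ge> 2\<close> leaves has order \<open>k ^ (2 * L - 4)\<close> relative to \<open>fact k\<close>. For
  \<open>L < n\<close> this is at most \<open>k ^ (2 * n - 6)\<close>, while the term \<open>n / k * tau k n\<close> has order
  \<open>k ^ (2 * n - 5)\<close> and dominates.\<close>

lemma A_top_asymp:
  assumes n: "n \<ge> 3"
  shows "(\<lambda>k. real (A_top n k)) \<sim>[at_top]
    (\<lambda>k. fact k / (2 ^ (n - 2) * fact (n - 2) * fact (n - 1)) * real k ^ (2 * n - 5))"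
proof -
  let ?g = "\<lambda>k. fact k * real k ^ (2 * n - 5)"
  let ?C = "2 ^ (n - 2) * fact (n - 2) * fact (n - 1) :: real"
  have small: "(\<lambda>k. real (tau k L) / ?g k) \<longlonglongrightarrow> 0" if L: "L < n" for L
  proof (cases "L < 2")
    case True
    show ?thesis
    proof (rule tendsto_eventually)
      show "\<forall>\<^sub>F k in sequentially. real (tau k L) / ?g k = 0"
        using eventually_ge_at_top[of 2] by eventually_elim (simp add: True tau_less_2)
    qed
  next
    case False
    define e where "e = 2 * n - 5 - 2 * (L - 2)"
    have e: "2 * n - 5 = 2 * (L - 2) + e" "e > 0" using False L n unfolding e_def by auto
    have "(\<lambda>k. inverse (real k) ^ e) \<longlonglongrightarrow> 0 ^ e" by (intro tendsto_power lim_inverse_n)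
    then have "(\<lambda>k. real (tau k L) / (fact k * real k ^ (2 * (L - 2))) * inverse (real k) ^ e)
        \<longlonglongrightarrow> 1 / (2 ^ (L - 2) * fact (L - 2) * fact L) * 0 ^ e"
      using False by (intro tendsto_mult tau_asymp) auto
    moreover have "real (tau k L) / (fact k * real k ^ (2 * (L - 2))) * inverse (real k) ^ e =
        real (tau k L) / ?g k" for k
      unfolding e by (simp add: power_add power_inverse field_simps)
    ultimately show ?thesis using e by (simp add: zero_power)
  qed
  have "(\<lambda>k. real n * (real (tau k n) / (fact k * real k ^ (2 * (n - 2)))))
      \<longlonglongrightarrow> real n * (1 / (2 ^ (n - 2) * fact (n - 2) * fact n))"
    using n by (intro tendsto_mult tendsto_const tau_asymp) auto
  moreover have "real n * (1 / (2 ^ (n - 2) * fact (n - 2) * fact n)) = 1 / ?C"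
    using n by (simp add: fact_reduce[of n])
  moreover have "real n * (real (tau k n) / (fact k * real k ^ (2 * (n - 2)))) =
      real n / real k * real (tau k n) / ?g k" for k
  proof -
    have "2 * (n - 2) = Suc (2 * n - 5)" using n by auto
    then show ?thesis by simp
  qed
  ultimately have main: "(\<lambda>k. real n / real k * real (tau k n) / ?g k) \<longlonglongrightarrow> 1 / ?C"
    by (simp only:)
  have "(\<lambda>k. ((\<Sum>L<n. real (tau k L) / ?g k) + real n / real k * real (tau k n) / ?g k) * ?C)
      \<longlonglongrightarrow> ((\<Sum>L<n. 0) + 1 / ?C) * ?C"
    by (intro tendsto_mult tendsto_add tendsto_sum tendsto_const small main) auto
  moreover have "\<forall>\<^sub>F k in sequentially.
      ((\<Sum>L<n. real (tau k L) / ?g k) + real n / real k * real (tau k n) / ?g k) * ?C =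
      real (A_top n k) / (fact k / ?C * real k ^ (2 * n - 5))"
    using eventually_ge_at_top[of 1]
  proof eventually_elim
    case (elim k)
    have "(\<Sum>L<n. real (tau k L) / ?g k) + real n / real k * real (tau k n) / ?g k =
        real (A_top n k) / ?g k"
      unfolding A_top_eq_tau_field[OF elim] by (simp only: add_divide_distrib sum_divide_distrib)
    then show ?case by simp
  qed
  ultimately have "(\<lambda>k. real (A_top n k) / (fact k / ?C * real k ^ (2 * n - 5))) \<longlonglongrightarrow>
      ((\<Sum>L<n. 0) + 1 / ?C) * ?C"
    by (rule Lim_transform_eventually)
  then show ?thesis by (intro asymp_equivI') simp
qed

section \<open>Cayley's formula and factorial moments of the number of leaves\<close>

text \<open>Stirling numbers convert powers into falling factorials: multiplying by
  \<open>x = (x - j) + j\<close> reproduces their recurrence.\<close>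

lemma power_eq_sum_Stirling:
  fixes x :: "'a :: comm_ring_1"
  shows "x ^ m = (\<Sum>j\<le>m. of_nat (Stirling m j) * (\<Prod>i<j. x - of_nat i))"
proof (induction m)
  case (Suc m)
  define F where "F j = (\<Prod>i<j. x - of_nat i)" for j
  define S where "S j = (of_nat (Stirling m j) :: 'a)" for j
  have F: "F (Suc j) = F j * (x - of_nat j)" for j by (simp add: F_def)
  have "x ^ Suc m = (\<Sum>j\<le>m. S j * F j) * x"
    using Suc by (simp add: F_def S_def mult.commute)
  also have "\<dots> = (\<Sum>j\<le>m. S j * F (Suc j)) + (\<Sum>j\<le>m. of_nat j * S j * F j)"
    unfolding sum_distrib_right sum.distrib[symmetric]
    by (intro sum.cong refl) (simp add: F algebra_simps)
  also have "(\<Sum>j\<le>m. of_nat j * S j * F j) = (\<Sum>j\<le>Suc m. of_nat j * S j * F j)"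
    by (simp add: S_def)
  also have "\<dots> = (\<Sum>j\<le>m. of_nat (Suc j) * S (Suc j) * F (Suc j))"
    by (subst sum.atMost_Suc_shift) simp
  also have "(\<Sum>j\<le>m. S j * F (Suc j)) + \<dots> =
      (\<Sum>j\<le>m. of_nat (Stirling (Suc m) (Suc j)) * F (Suc j))"
    unfolding sum.distrib[symmetric] by (intro sum.cong refl) (simp add: S_def algebra_simps)
  also have "\<dots> = (\<Sum>j\<le>Suc m. of_nat (Stirling (Suc m) j) * F j)"
    by (subst sum.atMost_Suc_shift) simp
  finally show ?case by (simp only: F_def)
qed simp

lemma sum_over_leaves:
  fixes w :: "nat \<Rightarrow> 'a :: semiring_1"
  shows "(\<Sum>E\<in>labeled_trees k. w (card (leaves k E))) = (\<Sum>L\<le>k. w L * of_nat (tau k L))"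
proof -
  have "(\<Sum>L\<le>k. w L * of_nat (tau k L)) =
      (\<Sum>L\<le>k. \<Sum>E\<in>{E\<in>labeled_trees k. card (leaves k E) = L}. w (card (leaves k E)))"
    by (simp add: tau_def mult_of_nat_commute)
  also have "\<dots> = (\<Sum>E\<in>labeled_trees k. w (card (leaves k E)))"
    by (rule sum.group) (auto simp: card_leaves_le)
  finally show ?thesis ..
qed

text \<open>Cayley's formula. By \<open>tau_Stirling\<close> the total over all leaf numbers is the expansion of
  \<open>k ^ (k - 2)\<close> into falling factorials, whose value at \<open>k\<close> is \<open>fact k / fact (k - j)\<close>.\<close>

lemma card_labeled_trees:
  assumes "k \<ge> 2"
  shows "card (labeled_trees k) = k ^ (k - 2)"
proof -
  define m where "m = k - 2"
  let ?k = "m + 2"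
  have falling: "fact ?k / fact (?k - j) = (\<Prod>i<j. real ?k - real i)" if "j \<le> ?k" for j
    using that
  proof (induction j)
    case (Suc j)
    then have "?k - j = Suc (?k - Suc j)" by simp
    then have "(fact (?k - j) :: real) = real (?k - j) * fact (?k - Suc j)" by (metis fact_Suc)
    then have "(fact (?k - j) :: real) = (real ?k - real j) * fact (?k - Suc j)"
      using Suc.prems by (simp only: of_nat_diff Suc_leD)
    moreover have "real ?k - real j \<noteq> 0" using Suc.prems by simp
    ultimately have "(fact ?k :: real) / fact (?k - Suc j) = fact ?k / fact (?k - j) * (real ?k - real j)"
      by (simp del: fact_Suc)
    then show ?case using Suc by (simp only: prod.lessThan_Suc Suc_leD)
  qed simp
  have "real (card (labeled_trees ?k)) = (\<Sum>L\<le>?k. real (tau ?k L))"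
    using sum_over_leaves[of "\<lambda>_. 1 :: real" ?k] by simp
  also have "\<dots> = (\<Sum>L\<le>?k. fact ?k / fact L * real (Stirling m (?k - L)))"
  proof (intro sum.cong refl)
    fix L assume "L \<in> {..?k}"
    then have "real (fact L * tau ?k L) = real (fact ?k * Stirling m (?k - L))"
      using tau_Stirling[of L m] by simp
    then have "fact L * real (tau ?k L) = fact ?k * real (Stirling m (?k - L))"
      by (simp only: of_nat_mult of_nat_fact)
    then show "real (tau ?k L) = fact ?k / fact L * real (Stirling m (?k - L))"
      by (simp add: field_simps del: fact_Suc)
  qed
  also have "\<dots> = (\<Sum>j\<le>?k. fact ?k / fact (?k - j) * real (Stirling m j))"
    by (rule sum.reindex_bij_witness[of _ "\<lambda>j. ?k - j" "\<lambda>j. ?k - j"]) auto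
  also have "\<dots> = (\<Sum>j\<le>?k. real (Stirling m j) * (\<Prod>i<j. real ?k - real i))"
    by (intro sum.cong refl) (simp only: falling mult.commute atMost_iff)
  also have "\<dots> = (\<Sum>j\<le>m. real (Stirling m j) * (\<Prod>i<j. real ?k - real i))"
    by (rule sum.mono_neutral_right) auto
  also have "\<dots> = real ?k ^ m" by (rule power_eq_sum_Stirling[symmetric])
  finally have "card (labeled_trees ?k) = ?k ^ m" by (metis of_nat_eq_iff of_nat_power)
  moreover have "?k = k" using assms by (simp add: m_def)
  ultimately show ?thesis by (simp only: m_def)
qed

text \<open>A sum over trees with a marked leaf becomes a sum over trees with one vertex less. The weights
  \<open>1\<close> and \<open>L - 1\<close> then give the first two factorial moments, because the factors that replace them
  are \<open>m\<close> and \<open>(m - 1) * l\<close>.\<close>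

lemma sum_leaves_rec:
  fixes w :: "nat \<Rightarrow> real"
  assumes m: "m \<ge> 2"
  shows "(\<Sum>L\<le>Suc m. w L * real L * real (tau (Suc m) L)) =
    real (Suc m) * (\<Sum>l\<le>m. (w l * real l + w (Suc l) * (real m - real l)) * real (tau m l))"
proof -
  define h where "h l = w (Suc l) * (real m - real l) * real (tau m l)" for l
  have rec: "w (Suc l) * real (Suc l) * real (tau (Suc m) (Suc l)) =
      real (Suc m) * (w (Suc l) * real (Suc l) * real (tau m (Suc l)) + h l)" if "l \<le> m" for l
  proof -
    have "real (Suc l) * real (tau (Suc m) (Suc l)) =
        real (Suc m) * (real (Suc l) * real (tau m (Suc l)) + (real m - real l) * real (tau m l))"
      using arg_cong[OF tau_rec[OF m, of l], of real] that
      by (simp only: of_nat_mult of_nat_add of_nat_diff)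
    then have "w (Suc l) * (real (Suc l) * real (tau (Suc m) (Suc l))) = w (Suc l) *
       (real (Suc m) * (real (Suc l) * real (tau m (Suc l)) + (real m - real l) * real (tau m l)))"
      by (simp only:)
    then show ?thesis unfolding h_def by (simp only: algebra_simps)
  qed
  \<comment> \<open>The boundary terms vanish: the weight contains the factor \<open>l\<close>, and \<open>tau m (Suc m) = 0\<close>.\<close>
  have shift: "(\<Sum>l\<le>m. w (Suc l) * real (Suc l) * real (tau m (Suc l))) =
      (\<Sum>l\<le>m. w l * real l * real (tau m l))"
  proof -
    have "(\<Sum>l\<le>m. w (Suc l) * real (Suc l) * real (tau m (Suc l))) =
        (\<Sum>l\<le>Suc m. w l * real l * real (tau m l))"
      by (subst sum.atMost_Suc_shift) simp
    then show ?thesis by (simp add: tau_eq_0)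
  qed
  have "(\<Sum>L\<le>Suc m. w L * real L * real (tau (Suc m) L)) =
      (\<Sum>l\<le>m. w (Suc l) * real (Suc l) * real (tau (Suc m) (Suc l)))"
    by (subst sum.atMost_Suc_shift) simp
  also have "\<dots> = real (Suc m) *
      ((\<Sum>l\<le>m. w (Suc l) * real (Suc l) * real (tau m (Suc l))) + (\<Sum>l\<le>m. h l))"
    unfolding sum.distrib[symmetric] sum_distrib_left
    by (intro sum.cong refl) (simp only: rec atMost_iff)
  also have "\<dots> = real (Suc m) *
      (\<Sum>l\<le>m. (w l * real l + w (Suc l) * (real m - real l)) * real (tau m l))"
    unfolding shift sum.distrib[symmetric] h_def by (simp only: algebra_simps)
  finally show ?thesis .
qed

lemma sum_leaves:
  assumes m: "m \<ge> 2"
  shows "(\<Sum>L\<le>Suc m. real L * real (tau (Suc m) L)) =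
    real (Suc m) * real m * real (card (labeled_trees m))"
proof -
  have "(\<Sum>l\<le>m. real (tau m l)) = real (card (labeled_trees m))"
    using sum_over_leaves[of "\<lambda>_. 1 :: real" m] by simp
  then show ?thesis using sum_leaves_rec[OF m, of "\<lambda>_. 1"]
    by (simp flip: sum_distrib_left)
qed

lemma sum_leaves_falling:
  assumes m: "m \<ge> 2"
  shows "(\<Sum>L\<le>m + 2. (real L - 1) * real L * real (tau (m + 2) L)) =
    real (m + 2) * real (m + 1) * real m ^ 2 * real (card (labeled_trees m))"
proof -
  have "(\<Sum>L\<le>Suc (Suc m). (real L - 1) * real L * real (tau (Suc (Suc m)) L)) =
      real (Suc (Suc m)) * (\<Sum>l\<le>Suc m. ((real l - 1) * real l +
        (real (Suc l) - 1) * (real (Suc m) - real l)) * real (tau (Suc m) l))"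
    by (rule sum_leaves_rec) (use m in simp)
  also have "\<dots> = real (Suc (Suc m)) * (real m * (\<Sum>l\<le>Suc m. real l * real (tau (Suc m) l)))"
    unfolding sum_distrib_left by (intro sum.cong refl) (simp add: algebra_simps)
  finally show ?thesis unfolding sum_leaves[OF m] by (simp add: power2_eq_square algebra_simps)
qed

section \<open>Concentration of the number of leaves\<close>

definition leaf_mean_square_deviation :: "nat \<Rightarrow> real" where
  "leaf_mean_square_deviation k =
    (\<Sum>E\<in>labeled_trees k. (real (card (leaves k E)) / real k - 1 / exp 1) ^ 2)
      / real (card (labeled_trees k))"

text \<open>Expanding the square leaves the two factorial moments, and Cayley's formula turns them into
  powers of \<open>(k - 1) / k\<close> and \<open>(k - 2) / k\<close>: the probabilities that one given vertex, or
  two, are leaves.\<close>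

lemma leaf_mean_square_deviation_eq:
  assumes k: "k \<ge> 4"
  defines "c \<equiv> 1 / exp 1"
  shows "leaf_mean_square_deviation k =
    (real k - 1) / real k * ((real k - 2) / real k) ^ (k - 2) +
    (1 / real k - 2 * c) * ((real k - 1) / real k) ^ (k - 2) + c ^ 2"
proof -
  \<comment> \<open>Cayley's formula is used for \<open>k\<close>, \<open>k - 1\<close> and \<open>k - 2\<close>; with \<open>k = m + 4\<close> no exponent is
    truncated.\<close>
  obtain m where m: "k = Suc (Suc (m + 2))"
    using k that[of "k - 4"] by (simp add: eval_nat_numeral)
  let ?t = "\<lambda>j. real (card (labeled_trees j))"
  have t0: "?t k = real k ^ (m + 2)" "?t (k - 1) = (real k - 1) ^ (m + 1)" "?t (k - 2) = (real k - 2) ^ m"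
  proof -
    have "k - 2 = m + 2" "k - 1 - 2 = m + 1" "k - 2 - 2 = m" by (simp_all add: m)
    moreover have "real (k - 1) = real k - 1" "real (k - 2) = real k - 2"
      using k by (simp_all add: of_nat_diff)
    ultimately show "?t k = real k ^ (m + 2)" "?t (k - 1) = (real k - 1) ^ (m + 1)"
      "?t (k - 2) = (real k - 2) ^ m"
      using k card_labeled_trees[of k] card_labeled_trees[of "k - 1"] card_labeled_trees[of "k - 2"]
      by (simp_all only: of_nat_power)
  qed
  have kpos: "real k > 0" using k by simp
  have M1: "(\<Sum>L\<le>k. real L * real (tau k L)) = real k * (real k - 1) * ?t (k - 1)"
    using sum_leaves[of "k - 1"] k by (simp add: of_nat_diff)
  have M2: "(\<Sum>L\<le>k. (real L - 1) * real L * real (tau k L)) =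
      real k * (real k - 1) * (real k - 2) ^ 2 * ?t (k - 2)"
    using sum_leaves_falling[of "k - 2"] k by (simp add: m)
  have M0: "(\<Sum>L\<le>k. real (tau k L)) = ?t k"
    using sum_over_leaves[of "\<lambda>_. 1 :: real" k] by simp
  have "(\<Sum>E\<in>labeled_trees k. (real (card (leaves k E)) / real k - c) ^ 2) =
      (\<Sum>L\<le>k. (real L / real k - c) ^ 2 * real (tau k L))"
    by (rule sum_over_leaves)
  also have "\<dots> = (\<Sum>L\<le>k. 1 / real k ^ 2 * ((real L - 1) * real L * real (tau k L)) +
      (1 / real k ^ 2 - 2 * c / real k) * (real L * real (tau k L)) + c ^ 2 * real (tau k L))"
    using kpos by (intro sum.cong refl) (simp add: field_simps power2_eq_square)
  also have "\<dots> = 1 / real k ^ 2 * (real k * (real k - 1) * (real k - 2) ^ 2 * ?t (k - 2)) +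
      (1 / real k ^ 2 - 2 * c / real k) * (real k * (real k - 1) * ?t (k - 1)) + c ^ 2 * ?t k"
    unfolding sum.distrib sum_distrib_left[symmetric] M0 M1 M2 ..
  also have "\<dots> = ((real k - 1) / real k * ((real k - 2) / real k) ^ (m + 2) +
      (1 / real k - 2 * c) * ((real k - 1) / real k) ^ (m + 2) + c ^ 2) * ?t k"
    unfolding t0 using kpos by (simp add: field_simps power2_eq_square)
  finally have "(\<Sum>E\<in>labeled_trees k. (real (card (leaves k E)) / real k - c) ^ 2) =
      ((real k - 1) / real k * ((real k - 2) / real k) ^ (m + 2) +
      (1 / real k - 2 * c) * ((real k - 1) / real k) ^ (m + 2) + c ^ 2) * ?t k" .
  moreover have "?t k \<noteq> 0" unfolding t0 using kpos by simp
  moreover have "m + 2 = k - 2" by (simp add: m)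
  ultimately show ?thesis
    unfolding leaf_mean_square_deviation_def c_def 
    by (simp only: nonzero_mult_div_cancel_right not_False_eq_True)
qed

lemma tendsto_one_minus_div_power:
  "(\<lambda>k. ((real k - a) / real k) ^ (k - 2)) \<longlonglongrightarrow> exp (- a)"
proof -
  have "(\<lambda>k. (1 + (- a) / real k) ^ k / (1 - a * inverse (real k)) ^ 2) \<longlonglongrightarrow> exp (- a) / (1 - a * 0) ^ 2"
    by (intro tendsto_divide tendsto_exp_limit_sequentially tendsto_power tendsto_diff tendsto_mult
        tendsto_const lim_inverse_n) simp
  moreover have "\<forall>\<^sub>F k in sequentially. (1 + (- a) / real k) ^ k / (1 - a * inverse (real k)) ^ 2 =
      ((real k - a) / real k) ^ (k - 2)"
    using eventually_gt_at_top[of "nat \<lceil>\<bar>a\<bar>\<rceil> + 2"]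
  proof eventually_elim
    case (elim k)
    define x where "x = (real k - a) / real k"
    have "real k > a" "k \<ge> 2" using elim by linarith+
    then have "x \<noteq> 0" "1 + (- a) / real k = x" "1 - a * inverse (real k) = x" "k = (k - 2) + 2"
      by (auto simp: x_def field_simps)
    moreover have "x ^ k = x ^ (k - 2) * x ^ 2"
      using \<open>k = (k - 2) + 2\<close> by (metis power_add)
    ultimately show ?case unfolding x_def[symmetric] by simp
  qed
  ultimately show ?thesis by (simp add: tendsto_cong)
qed

text \<open>Asymptotically two vertices are leaves independently, each with probability \<open>1 / e\<close>, so the
  three terms of the mean square cancel.\<close>

lemma leaf_mean_square_deviation_tendsto_0: "leaf_mean_square_deviation \<longlonglongrightarrow> 0"
proof -
  define c :: real where "c = 1 / exp 1"
  have c: "exp (- 1) = c" "exp (- 2) = c ^ 2"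
    by (simp_all add: c_def exp_minus field_simps power2_eq_square flip: exp_add)
  have "(\<lambda>k. (1 - inverse (real k)) * ((real k - 2) / real k) ^ (k - 2) +
      (inverse (real k) - 2 * c) * ((real k - 1) / real k) ^ (k - 2) + c ^ 2) \<longlonglongrightarrow>
      (1 - 0) * exp (- 2) + (0 - 2 * c) * exp (- 1) + c ^ 2"
    by (intro tendsto_add tendsto_mult tendsto_diff tendsto_const lim_inverse_n
        tendsto_one_minus_div_power)
  moreover have "\<forall>\<^sub>F k in sequentially. (1 - inverse (real k)) * ((real k - 2) / real k) ^ (k - 2) +
      (inverse (real k) - 2 * c) * ((real k - 1) / real k) ^ (k - 2) + c ^ 2 =
      leaf_mean_square_deviation k"
    using eventually_ge_at_top[of 4]
  proof eventually_elim
    case (elim k)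
    have "(real k - 1) / real k = 1 - inverse (real k)" using elim by (simp add: field_simps)
    then show ?case
      unfolding leaf_mean_square_deviation_eq[OF elim] c_def by (simp add: inverse_eq_divide)
  qed
  moreover have "(1 - 0) * exp (- 2) + (0 - 2 * c) * exp (- 1) + c ^ 2 = 0"
    unfolding c by (simp add: power2_eq_square)
  ultimately show ?thesis by (simp only: tendsto_cong)
qed

lemma labeled_trees_nonempty: "k \<ge> 2 \<Longrightarrow> labeled_trees k \<noteq> {}"
  using card_labeled_trees[of k] by auto

lemma leaves_Chebyshev:
  assumes S: "S \<subseteq> labeled_trees k" and "\<delta> > 0"
    and far: "\<And>E. E \<in> S \<Longrightarrow> \<bar>real (card (leaves k E)) / real k - 1 / exp 1\<bar> \<ge> \<delta>"
  shows "real (card S) / real (card (labeled_trees k)) \<le> leaf_mean_square_deviation k / \<delta> ^ 2"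
proof -
  let ?d = "\<lambda>E. (real (card (leaves k E)) / real k - 1 / exp 1) ^ 2"
  have "\<delta> ^ 2 * real (card S) = (\<Sum>E\<in>S. \<delta> ^ 2)" by simp
  also have "\<dots> \<le> (\<Sum>E\<in>S. ?d E)"
  proof (rule sum_mono)
    fix E assume "E \<in> S"
    from power_mono[OF far[OF this], of 2] show "\<delta> ^ 2 \<le> ?d E" using \<open>\<delta> > 0\<close> by simp
  qed
  also have "\<dots> \<le> (\<Sum>E\<in>labeled_trees k. ?d E)"
    using S by (intro sum_mono2) auto
  finally have "real (card S) \<le> (\<Sum>E\<in>labeled_trees k. ?d E) / \<delta> ^ 2"
    using \<open>\<delta> > 0\<close> by (simp add: field_simps)
  then have "real (card S) / real (card (labeled_trees k)) \<le>
      (\<Sum>E\<in>labeled_trees k. ?d E) / \<delta> ^ 2 / real (card (labeled_trees k))"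
    by (rule divide_right_mono) simp
  then show ?thesis unfolding leaf_mean_square_deviation_def by (simp add: mult.commute)
qed

section \<open>The threshold for random trees\<close>

lemma prob_top_star_eq:
  assumes "k \<ge> 2"
  shows "prob_top_star n k =
    real (card {U \<in> labeled_trees k. has_top_star n k U}) / real (card (labeled_trees k))"
  unfolding prob_top_star_def
  using labeled_trees_nonempty[OF assms] by (simp add: measure_pmf_of_set Int_def)

lemma prob_top_star_complement:
  assumes "k \<ge> 2"
  shows "prob_top_star n k =
    1 - real (card {U \<in> labeled_trees k. \<not> has_top_star n k U}) / real (card (labeled_trees k))"
proof -
  have "card (labeled_trees k) = card ({U \<in> labeled_trees k. has_top_star n k U} \<union>
      {U \<in> labeled_trees k. \<not> has_top_star n k U})"
    by (rule arg_cong[where f = card]) auto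
  also have "\<dots> = card {U \<in> labeled_trees k. has_top_star n k U} +
      card {U \<in> labeled_trees k. \<not> has_top_star n k U}"
    by (rule card_Un_disjoint) auto
  finally have "real (card (labeled_trees k)) = real (card {U \<in> labeled_trees k. has_top_star n k U}) +
      real (card {U \<in> labeled_trees k. \<not> has_top_star n k U})" by simp
  moreover have "real (card (labeled_trees k)) \<noteq> 0" using labeled_trees_nonempty[OF assms] by simp
  ultimately show ?thesis unfolding prob_top_star_eq[OF assms] by (simp add: field_simps)
qed

lemma prob_top_star_tendsto_1:
  assumes "limsup (\<lambda>k. ereal (real (n k) / real k)) < ereal (1 / exp 1)"
  shows "(\<lambda>k. prob_top_star (n k) k) \<longlonglongrightarrow> 1"
proof -
  obtain r where r: "limsup (\<lambda>k. ereal (real (n k) / real k)) < ereal r" "r < 1 / exp 1"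
    using ereal_dense2[OF assms] by auto
  define \<delta> where "\<delta> = 1 / exp 1 - r"
  have \<delta>: "\<delta> > 0" using r by (simp add: \<delta>_def)
  have lower: "\<forall>\<^sub>F k in sequentially. 1 - leaf_mean_square_deviation k / \<delta> ^ 2 \<le> prob_top_star (n k) k"
    using Limsup_lessD[OF r(1)] eventually_ge_at_top[of 2]
  proof eventually_elim
    case (elim k)
    have "real (card {U \<in> labeled_trees k. \<not> has_top_star (n k) k U}) / real (card (labeled_trees k))
        \<le> leaf_mean_square_deviation k / \<delta> ^ 2"
    proof (rule leaves_Chebyshev)
      fix U assume "U \<in> {U \<in> labeled_trees k. \<not> has_top_star (n k) k U}"
      then have "card (leaves k U - {k}) < n k"
        using has_top_star_iff_leaves[of U k "n k"] elim by auto
      \<comment> \<open>Not \<open><\<close>: the top vertex may be one more leaf.\<close>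
      then have "card (leaves k U) \<le> n k" by (auto simp: card_Diff_singleton_if split: if_splits)
      then have "real (card (leaves k U)) / real k \<le> real (n k) / real k"
        by (intro divide_right_mono) auto
      then show "\<delta> \<le> \<bar>real (card (leaves k U)) / real k - 1 / exp 1\<bar>"
        using elim(1) by (simp add: \<delta>_def)
    qed (use \<delta> in auto)
    then show ?case unfolding prob_top_star_complement[OF elim(2)] by simp
  qed
  have "(\<lambda>k. 1 - leaf_mean_square_deviation k / \<delta> ^ 2) \<longlonglongrightarrow> 1 - 0 / \<delta> ^ 2"
    using \<delta> by (intro tendsto_diff tendsto_divide tendsto_const leaf_mean_square_deviation_tendsto_0) simp
  then have lim: "(\<lambda>k. 1 - leaf_mean_square_deviation k / \<delta> ^ 2) \<longlonglongrightarrow> 1" by simp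
  have upper: "\<forall>\<^sub>F k in sequentially. prob_top_star (n k) k \<le> 1"
    by (intro always_eventually) (simp add: prob_top_star_def)
  show ?thesis by (rule tendsto_sandwich[OF lower upper lim tendsto_const])
qed

lemma prob_top_star_tendsto_0:
  assumes "liminf (\<lambda>k. ereal (real (n k) / real k)) > ereal (1 / exp 1)"
  shows "(\<lambda>k. prob_top_star (n k) k) \<longlonglongrightarrow> 0"
proof -
  obtain r where r: "ereal r < liminf (\<lambda>k. ereal (real (n k) / real k))" "1 / exp 1 < r"
    using ereal_dense2[OF assms] by auto
  define \<delta> where "\<delta> = r - 1 / exp 1"
  have \<delta>: "\<delta> > 0" using r by (simp add: \<delta>_def)
  have upper: "\<forall>\<^sub>F k in sequentially. prob_top_star (n k) k \<le> leaf_mean_square_deviation k / \<delta> ^ 2"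
    using less_LiminfD[OF r(1)] eventually_ge_at_top[of 2]
  proof eventually_elim
    case (elim k)
    show ?case unfolding prob_top_star_eq[OF elim(2)]
    proof (rule leaves_Chebyshev)
      fix U assume "U \<in> {U \<in> labeled_trees k. has_top_star (n k) k U}"
      then have "n k \<le> card (leaves k U - {k})"
        using has_top_star_iff_leaves[of U k "n k"] elim by auto
      also have "\<dots> \<le> card (leaves k U)" by (rule card_mono) auto
      finally have "real (n k) / real k \<le> real (card (leaves k U)) / real k"
        by (intro divide_right_mono) auto
      then show "\<delta> \<le> \<bar>real (card (leaves k U)) / real k - 1 / exp 1\<bar>"
        using elim(1) by (simp add: \<delta>_def)
    qed (use \<delta> in auto)
  qed
  have "(\<lambda>k. leaf_mean_square_deviation k / \<delta> ^ 2) \<longlonglongrightarrow> 0 / \<delta> ^ 2"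
    using \<delta> by (intro tendsto_divide tendsto_const leaf_mean_square_deviation_tendsto_0) simp
  then have lim: "(\<lambda>k. leaf_mean_square_deviation k / \<delta> ^ 2) \<longlonglongrightarrow> 0" by simp
  have lower: "\<forall>\<^sub>F k in sequentially. 0 \<le> prob_top_star (n k) k"
    by (intro always_eventually) (simp add: prob_top_star_def)
  show ?thesis by (rule tendsto_sandwich[OF lower upper tendsto_const lim])
qed

(* A rational function equal to a power series has no pole at 0, so its denominator Q may be
   taken with Q(0) \<noteq> 0; then the division of power series below is the genuine quotient. *)
theorem theorem1p6:
  shows "(\<forall>n::nat. n \<ge> 3 \<longrightarrow>
      (\<forall>k::nat. k \<ge> 2 \<longrightarrow>
         real (A_top n k) = (\<Sum>L = 0..n - 1. real (tau k L)) + real n / real k * real (tau k n))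
    \<and> A_top_series n =
        (\<Sum>L = 0..n - 1. T_series L) + of_nat n * fps_integral0 (T_series n / fps_X)
    \<and> (\<exists>(P :: rat poly) (Q :: rat poly) (\<gamma> :: rat). coeff Q 0 \<noteq> 0 \<and>
         A_top_series n = fps_of_poly P / fps_of_poly Q - fps_const \<gamma> * log_one_minus)
    \<and> (\<lambda>k. real (A_top n k)) \<sim>[at_top]
        (\<lambda>k. fact k / (2 ^ (n - 2) * fact (n - 2) * fact (n - 1)) * real k ^ (2 * n - 5)))
  \<and> (\<forall>n :: nat \<Rightarrow> nat. (\<forall>\<^sub>F k in at_top. 3 \<le> n k \<and> n k < k) \<longrightarrow>
      (limsup (\<lambda>k. ereal (real (n k) / real k)) < ereal (1 / exp 1) \<longrightarrow>
         (\<lambda>k. prob_top_star (n k) k) \<longlonglongrightarrow> 1)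
    \<and> (liminf (\<lambda>k. ereal (real (n k) / real k)) > ereal (1 / exp 1) \<longrightarrow>
         (\<lambda>k. prob_top_star (n k) k) \<longlonglongrightarrow> 0))"
proof (intro conjI allI impI)
  fix n :: nat assume n: "n \<ge> 3"
  then have range: "{0..n - 1} = {..<n}" by auto
  show "real (A_top n k) = (\<Sum>L = 0..n - 1. real (tau k L)) + real n / real k * real (tau k n)"
    if "k \<ge> 2" for k
    unfolding range using A_top_eq_tau_field[of k n, where 'a = real] that by simp
  show "A_top_series n =
      (\<Sum>L = 0..n - 1. T_series L) + of_nat n * fps_integral0 (T_series n / fps_X)"
    unfolding range by (rule A_top_series_eq)
  show "\<exists>(P :: rat poly) (Q :: rat poly) (\<gamma> :: rat). coeff Q 0 \<noteq> 0 \<and>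
      A_top_series n = fps_of_poly P / fps_of_poly Q - fps_const \<gamma> * log_one_minus"
    by (rule A_top_series_rational_log)
  show "(\<lambda>k. real (A_top n k)) \<sim>[at_top]
      (\<lambda>k. fact k / (2 ^ (n - 2) * fact (n - 2) * fact (n - 1)) * real k ^ (2 * n - 5))"
    by (rule A_top_asymp[OF n])
qed (rule prob_top_star_tendsto_1 prob_top_star_tendsto_0; assumption)+

end
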